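(* Let $\tau\in(0,1)$, and let $p$ be a distribution on $\mathbb{R}^d$ $(d>2)$ such that: (1) $p=\mathcal{O}(p_1)$, where the density $p_1$ on $\mathbb{R}^d$ satisfies $p_1(z)\propto\exp(-\|z\|_2^{\tau})$; (2) $\|\nabla p\|_2=\mathcal{O}(\|\nabla p_2\|_2)$, where the density $p_2$ on $\mathbb{R}^d$ satisfies \[p_2(z)\propto\begin{cases}\exp(-d), & \|z\|_2\le d^{1/\tau},\\ \exp(-\|z\|_2^{\tau}), & \|z\|_2>d^{1/\tau}.\end{cases}\] Suppose $\mathcal{F}$ is the set of all $c_h$-local planar flows on $\mathbb{R}^d$, and let $q$ be a distribution on $\mathbb{R}^d$ with $\|p-q\|_1=\Theta(1)$. Then there exists $\epsilon=\Theta(1)$ such that \[T_{\epsilon}(p,q,\mathcal{F})=\Omega\left(\min\left((\log d)^{-\frac1\tau}\,d^{\frac1\tau-\frac12},\; d^{\frac1\tau-1}\right)\right).\]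
   Context: Distributions on $\mathbb{R}^d$ are identified with their densities. The symbols $\mathcal{O},\Theta,\Omega$ refer to the dimension $d$ growing, with $\tau$ and $c_h$ fixed (so $p=p^{(d)}$, $q=q^{(d)}$, and the implied constants do not depend on $d$ or on the point $z$). A normalizing flow on $\mathbb{R}^d$ is an invertible function $f:\mathbb{R}^d\to\mathbb{R}^d$, differentiable almost everywhere, with $\det J_f(z)\neq0$ for almost every $z$, where $J_f$ is the Jacobian matrix. If $z$ has density $q$, $f\#q$ denotes the density of $f(z)$, given by $(f\#q)(f(z))=q(z)/|\det J_f(z)|$. A non-linearity $h:\mathbb{R}\to\mathbb{R}$ is called $c_h$-local, for a constant $c_h\in\mathbb{R}$, if for all $x\in\mathbb{R}$: $|h(x)|\le c_h$ and $|h'(x)|\le c_h/(1+|x|)$. A $c_h$-local planar flow on $\mathbb{R}^d$ is a normalizing flow of the form $f(z)=z+u\,h(w^{\top}z+b)$ with $h$ $c_h$-local, $u,w\in\mathbb{R}^d$, $b\in\mathbb{R}$, $\|u\|_2\le1$, $\|w\|_2\le1$. For a set $\mathcal F$ of normalizing flows and $\epsilon>0$, \[T_\epsilon(p,q,\mathcal F)=\inf\{n:\exists f_1,\dots,f_n\in\mathcal F\text{ such that }\|(f_1\circ\cdots\circ f_n)\#q-p\|_1\le\epsilon\},\] where $\|\cdot\|_1$ is the $\ell_1$ (i.e. $L^1(\mathbb{R}^d)$) norm. *)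

theory Defs
  imports
    "HOL-Probability.Probability"
    "HOL-Library.Landau_Symbols"
    "Jordan_Normal_Form.Determinant"
begin

text \<open>
  The dimension \<open>d\<close> tends to infinity, so it cannot be a type.  A point of \<open>d\<close>-dimensional real
  space is a function \<open>nat \<Rightarrow> real\<close> that is extensional on \<open>{..<d}\<close>, and Lebesgue measure is the
  product measure on these functions.  All functions on the space are only looked at on \<open>Rn d\<close>.
\<close>

definition lebn :: "nat \<Rightarrow> (nat \<Rightarrow> real) measure" where
  "lebn d = PiM {..<d} (\<lambda>_. lborel)"

definition Rn :: "nat \<Rightarrow> (nat \<Rightarrow> real) set" where
  "Rn d = (\<Pi>\<^sub>E i\<in>{..<d}. UNIV)"

lemma space_lebn: "space (lebn d) = Rn d"
  by (simp add: lebn_def Rn_def space_PiM)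

definition dotn :: "nat \<Rightarrow> (nat \<Rightarrow> real) \<Rightarrow> (nat \<Rightarrow> real) \<Rightarrow> real" where
  "dotn d x y = (\<Sum>i<d. x i * y i)"

abbreviation normn :: "nat \<Rightarrow> (nat \<Rightarrow> real) \<Rightarrow> real" where
  "normn d x \<equiv> L2_set x {..<d}"

definition gradn :: "nat \<Rightarrow> ((nat \<Rightarrow> real) \<Rightarrow> real) \<Rightarrow> (nat \<Rightarrow> real) \<Rightarrow> (nat \<Rightarrow> real)" where
  "gradn d g z = (\<lambda>i\<in>{..<d}. deriv (\<lambda>t. g (z(i := t))) (z i))"

text \<open>
  Total (Frechet) differentiability.  A derivative \<open>G\<close> necessarily consists of the partial
  derivatives, i.e. it is \<open>gradn d g z\<close>.
\<close>

definition diffn :: "nat \<Rightarrow> ((nat \<Rightarrow> real) \<Rightarrow> real) \<Rightarrow> (nat \<Rightarrow> real) \<Rightarrow> bool" where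
  "diffn d g z \<longleftrightarrow>
     (\<exists>G. \<forall>e>0. \<exists>r>0. \<forall>y\<in>Rn d. normn d (\<lambda>i. y i - z i) < r \<longrightarrow>
        \<bar>g y - g z - dotn d G (\<lambda>i. y i - z i)\<bar> \<le> e * normn d (\<lambda>i. y i - z i))"

definition jacobian :: "nat \<Rightarrow> ((nat \<Rightarrow> real) \<Rightarrow> (nat \<Rightarrow> real)) \<Rightarrow> (nat \<Rightarrow> real) \<Rightarrow> real mat" where
  "jacobian d f z = mat d d (\<lambda>(i, j). gradn d (\<lambda>y. f y i) z j)"

definition normalizing_flow :: "nat \<Rightarrow> ((nat \<Rightarrow> real) \<Rightarrow> (nat \<Rightarrow> real)) \<Rightarrow> bool" where
  "normalizing_flow d f \<longleftrightarrow>
     bij_betw f (Rn d) (Rn d) \<and>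
     (AE z in lebn d. \<forall>i<d. diffn d (\<lambda>y. f y i) z) \<and>
     (AE z in lebn d. Determinant.det (jacobian d f z) \<noteq> 0)"

definition is_density :: "nat \<Rightarrow> ((nat \<Rightarrow> real) \<Rightarrow> real) \<Rightarrow> bool" where
  "is_density d p \<longleftrightarrow>
     p \<in> borel_measurable (lebn d) \<and> (\<forall>z\<in>Rn d. 0 \<le> p z) \<and>
     integrable (lebn d) p \<and> (\<integral>z. p z \<partial>lebn d) = 1"

definition push_density ::
    "nat \<Rightarrow> ((nat \<Rightarrow> real) \<Rightarrow> (nat \<Rightarrow> real)) \<Rightarrow> ((nat \<Rightarrow> real) \<Rightarrow> real) \<Rightarrow> (nat \<Rightarrow> real) \<Rightarrow> real" where
  "push_density d f q y =
     (let z = the_inv_into (Rn d) f y in q z / \<bar>Determinant.det (jacobian d f z)\<bar>)"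

lemma push_density_apply:
  assumes "normalizing_flow d f" and "z \<in> Rn d"
  shows "push_density d f q (f z) = q z / \<bar>Determinant.det (jacobian d f z)\<bar>"
  using assms unfolding normalizing_flow_def push_density_def bij_betw_def
  by (simp add: the_inv_into_f_f)

definition L1_norm :: "nat \<Rightarrow> ((nat \<Rightarrow> real) \<Rightarrow> real) \<Rightarrow> real" where
  "L1_norm d g = (\<integral>z. \<bar>g z\<bar> \<partial>lebn d)"

definition local_nonlin :: "real \<Rightarrow> (real \<Rightarrow> real) \<Rightarrow> bool" where
  "local_nonlin c h \<longleftrightarrow>
     (\<forall>x. h differentiable (at x) \<and> \<bar>h x\<bar> \<le> c \<and> \<bar>deriv h x\<bar> \<le> c / (1 + \<bar>x\<bar>))"

definition planar_map ::
    "nat \<Rightarrow> (nat \<Rightarrow> real) \<Rightarrow> (nat \<Rightarrow> real) \<Rightarrow> real \<Rightarrow> (real \<Rightarrow> real) \<Rightarrow> (nat \<Rightarrow> real) \<Rightarrow> (nat \<Rightarrow> real)" where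
  "planar_map d u w b h z = (\<lambda>i\<in>{..<d}. z i + u i * h (dotn d w z + b))"

definition local_planar_flows :: "nat \<Rightarrow> real \<Rightarrow> ((nat \<Rightarrow> real) \<Rightarrow> (nat \<Rightarrow> real)) set" where
  "local_planar_flows d c =
     {f. normalizing_flow d f \<and>
         (\<exists>u\<in>Rn d. \<exists>w\<in>Rn d. \<exists>b h. f = planar_map d u w b h \<and>
            local_nonlin c h \<and> normn d u \<le> 1 \<and> normn d w \<le> 1)}"

text \<open>
  The infimum is taken in the extended naturals, so it is \<open>\<infinity>\<close> when no finite composition
  reaches accuracy \<open>\<epsilon>\<close>.  The empty composition (\<open>n = 0\<close>, the identity) is allowed.
\<close>

definition T_flow ::
    "nat \<Rightarrow> real \<Rightarrow> ((nat \<Rightarrow> real) \<Rightarrow> real) \<Rightarrow> ((nat \<Rightarrow> real) \<Rightarrow> real) \<Rightarrow>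
     ((nat \<Rightarrow> real) \<Rightarrow> (nat \<Rightarrow> real)) set \<Rightarrow> enat" where
  "T_flow d \<epsilon> p q F =
     Inf {enat n | n. \<exists>fs. length fs = n \<and> set fs \<subseteq> F \<and>
            L1_norm d (\<lambda>z. push_density d (foldr (\<circ>) fs id) q z - p z) \<le> \<epsilon>}"

definition normalized :: "nat \<Rightarrow> ((nat \<Rightarrow> real) \<Rightarrow> real) \<Rightarrow> (nat \<Rightarrow> real) \<Rightarrow> real" where
  "normalized d g z = g z / (\<integral>y. g y \<partial>lebn d)"

definition p1 :: "real \<Rightarrow> nat \<Rightarrow> (nat \<Rightarrow> real) \<Rightarrow> real" where
  "p1 \<tau> d = normalized d (\<lambda>z. exp (- (normn d z powr \<tau>)))"

definition p2 :: "real \<Rightarrow> nat \<Rightarrow> (nat \<Rightarrow> real) \<Rightarrow> real" where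
  "p2 \<tau> d = normalized d
     (\<lambda>z. if normn d z \<le> real d powr (1 / \<tau>) then exp (- real d)
          else exp (- (normn d z powr \<tau>)))"

end

theory Submission
  imports Defs "HOL-Real_Asymp.Real_Asymp"
begin

text \<open>
  A flow preserves \<open>L\<^sup>1\<close> distances, so the distance of \<open>q\<close> to \<open>p\<close> drops by at most
  \<open>L = sup \<parallel>f#p - p\<parallel>\<^sub>1\<close> per layer, and it suffices to show \<open>L = O(d powr (1 - 1 / \<tau>))\<close>.
  By the change of variables \<open>y = f z\<close>, \<open>\<parallel>f#p - p\<parallel>\<^sub>1\<close> is at most the integral of
  \<open>\<bar>p z - p (f z)\<bar> + p (f z) * \<bar>\<bar>det J\<bar> - 1\<bar>\<close>.

  For the first summand, the ball of radius \<open>d powr (1 / \<tau>) + c\<close> has exponentially small mass; this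
  also absorbs a possible jump of \<open>p\<close> at the sphere on which \<open>p2\<close> is not differentiable.  Outside
  of it the gradient of \<open>p\<close> is \<open>O(d powr (1 - 1 / \<tau>) * p2)\<close>.

  The second summand is at most a constant times \<open>p1 z * \<parallel>w\<parallel> / (1 + \<bar>w \<bullet> z + b\<bar>)\<close>.  The weight is dominated
  by an increment of a clamped logarithm along \<open>w / \<parallel>w\<parallel>\<close>; moving the translation onto \<open>p1\<close> costs
  \<open>O(ln d)\<close> times the \<open>L\<^sup>1\<close> distance of \<open>p1\<close> to its unit translates, which is \<open>O(d powr (1 / 2 - 1 / \<tau>))\<close>
  because under \<open>p1\<close> a fixed unit vector is nearly orthogonal to \<open>z\<close> on average.
\<close>

section \<open>Change of variables\<close>

text \<open>The non-linearity is differentiable, but its derivative may be discontinuous.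
  Substitutions are therefore reduced to one real variable, where a planar flow acts as
  \<open>s + dotn d w u * h s\<close>. The scale \<open>d powr (1 - 1 / \<tau>)\<close> is, up to
  the factor \<tau>, the size of the logarithmic gradient of \<open>p1\<close> at radius
  \<open>d powr (1 / \<tau>)\<close>. Under \<open>p1\<close> the variable
  \<open>normn d z powr \<tau>\<close> has a Gamma law with mean \<open>d / \<tau>\<close>, strictly
  above \<open>d\<close>; this is why the ball of that radius is exponentially rare. The obstacle is
  the Jacobian: near the hyperplane \<open>w \<bullet> z + b = 0\<close> it can differ from 1 by a
  constant, so a uniform pointwise bound is useless and the deviation has to be averaged. The
  numerator \<open>\<parallel>w\<parallel>\<close> must survive in that average, because a unit step
  in space moves \<open>w \<bullet> z\<close> by at most \<open>\<parallel>w\<parallel>\<close>.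
  Averaging loses a logarithm, but near orthogonality gains \<open>sqrt d\<close> over a plain
  Lipschitz bound, and \<open>sqrt d\<close> absorbs \<open>ln d\<close>. Only upper bounds on
  masses occur, so no normalizing constant is ever evaluated.\<close>

lemma borel_measurable_real_derivative:
  fixes \<phi> \<phi>' :: "real \<Rightarrow> real"
  assumes "\<And>x. (\<phi> has_real_derivative \<phi>' x) (at x)"
  shows "\<phi>' \<in> borel_measurable borel"
\<comment> \<open>The derivative is a pointwise limit of difference quotients of a continuous
  function; this gives measurability without continuity.\<close>
proof (rule borel_measurable_LIMSEQ_real)
  have [measurable]: "\<phi> \<in> borel_measurable borel"
    using assms by (intro borel_measurable_continuous_onI)
      (auto intro!: continuous_at_imp_continuous_on DERIV_isCont)
  show "(\<lambda>x. (\<phi> (x + inverse (real (Suc n))) - \<phi> x) / inverse (real (Suc n)))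
      \<in> borel_measurable borel" for n
    by measurable
  show "(\<lambda>n. (\<phi> (x + inverse (real (Suc n))) - \<phi> x) / inverse (real (Suc n)))
      \<longlonglongrightarrow> \<phi>' x" for x
  proof -
    have "((\<lambda>h. (\<phi> (x + h) - \<phi> x) / h) \<longlongrightarrow> \<phi>' x) (at 0)"
      using assms[of x] by (simp add: DERIV_def)
    moreover have "filterlim (\<lambda>n. inverse (real (Suc n))) (at 0) sequentially"
      by (intro filterlim_atI LIMSEQ_inverse_real_of_nat) auto
    ultimately show ?thesis
      by (rule filterlim_compose)
  qed
qed

text \<open>The measure with density \<open>\<phi>'\<close> is pushed forward by
  \<open>\<phi>\<close> and compared with \<open>lborel\<close> on intervals. There the claim is the
  fundamental theorem of calculus for a nonnegative derivative, which asks for measurability of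
  \<open>\<phi>'\<close> but not for continuity.\<close>

lemma nn_integral_strict_mono_deriv:
  fixes \<phi> \<phi>' :: "real \<Rightarrow> real" and k :: "real \<Rightarrow> ennreal"
  assumes bij: "bij \<phi>" and D: "\<And>x. (\<phi> has_real_derivative \<phi>' x) (at x)"
    and mono: "strict_mono \<phi>"
    and k[measurable]: "k \<in> borel_measurable borel"
  shows "(\<integral>\<^sup>+x. k (\<phi> x) * ennreal \<bar>\<phi>' x\<bar> \<partial>lborel) = (\<integral>\<^sup>+x. k x \<partial>lborel)"
proof -
  have [measurable]: "\<phi>' \<in> borel_measurable borel"
    by (rule borel_measurable_real_derivative[OF D])
  have [measurable]: "\<phi> \<in> borel_measurable borel"
    using D by (intro borel_measurable_continuous_onI)
      (auto intro!: continuous_at_imp_continuous_on DERIV_isCont)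
  have nonneg: "0 \<le> \<phi>' x" for x
    by (rule mono_on_imp_deriv_nonneg[of UNIV \<phi>])
      (use mono D in \<open>auto intro: strict_mono_mono simp: mono_imp_mono_on\<close>)
  define \<psi> where "\<psi> = inv_into UNIV \<phi>"
  have \<psi>: "\<phi> (\<psi> y) = y" "\<psi> (\<phi> x) = x" for x y
    using bij by (auto simp: \<psi>_def bij_is_surj surj_f_inv_f bij_is_inj)
  have less: "\<phi> x < y \<longleftrightarrow> x < \<psi> y" "y < \<phi> x \<longleftrightarrow> \<psi> y < x" "\<phi> x \<le> y \<longleftrightarrow> x \<le> \<psi> y" for x y
    using strict_mono_less[OF mono, of x "\<psi> y"] strict_mono_less[OF mono, of "\<psi> y" x]
      strict_mono_less_eq[OF mono, of x "\<psi> y"] by (auto simp: \<psi>)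
  define N where "N = distr (density lborel (\<lambda>x. ennreal \<bar>\<phi>' x\<bar>)) borel \<phi>"
  have "lborel = N"
  proof (rule lborel_eqI)
    fix l u :: real assume "\<And>b. b \<in> Basis \<Longrightarrow> l \<bullet> b \<le> u \<bullet> b"
    then have lu: "l \<le> u" by simp
    have vim: "\<phi> -` {l<..<u} = {\<psi> l<..<\<psi> u}"
      using less by auto
    have "emeasure N (box l u) = (\<integral>\<^sup>+x. ennreal \<bar>\<phi>' x\<bar> * indicator {\<psi> l<..<\<psi> u} x \<partial>lborel)"
      by (simp add: N_def emeasure_distr emeasure_density box_real vim)
    also have "\<dots> = (\<integral>\<^sup>+x. ennreal (\<phi>' x) * indicator {\<psi> l..\<psi> u} x \<partial>lborel)"
    proof (rule nn_integral_cong_AE)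
      show "AE x in lborel. ennreal \<bar>\<phi>' x\<bar> * indicator {\<psi> l<..<\<psi> u} x =
          ennreal (\<phi>' x) * indicator {\<psi> l..\<psi> u} x"
        using AE_lborel_singleton[of "\<psi> l"] AE_lborel_singleton[of "\<psi> u"]
        by eventually_elim (use nonneg in \<open>auto split: split_indicator\<close>)
    qed
    also have "\<dots> = \<phi> (\<psi> u) - \<phi> (\<psi> l)"
      by (rule nn_integral_FTC_Icc) (use D nonneg lu less(3)[of "\<psi> l" u] \<psi> in auto)
    finally show "emeasure N (box l u) = (\<Prod>b\<in>Basis. (u - l) \<bullet> b)"
      by (simp add: \<psi>)
  qed (simp add: N_def)
  then have "(\<integral>\<^sup>+x. k x \<partial>lborel) = (\<integral>\<^sup>+x. k x \<partial>N)"
    by simp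
  also have "\<dots> = (\<integral>\<^sup>+x. k (\<phi> x) * ennreal \<bar>\<phi>' x\<bar> \<partial>lborel)"
    unfolding N_def by (simp add: nn_integral_distr nn_integral_density mult.commute)
  finally show ?thesis by simp
qed

text \<open>A continuous injection of the line is strictly monotone. The decreasing case is the
  increasing one for \<open>- \<phi>\<close>, undone by the reflection invariance of
  \<open>lborel\<close>.\<close>

lemma nn_integral_bij_deriv:
  fixes \<phi> \<phi>' :: "real \<Rightarrow> real" and k :: "real \<Rightarrow> ennreal"
  assumes bij: "bij \<phi>" and D: "\<And>x. (\<phi> has_real_derivative \<phi>' x) (at x)"
    and k[measurable]: "k \<in> borel_measurable borel"
  shows "(\<integral>\<^sup>+x. k (\<phi> x) * ennreal \<bar>\<phi>' x\<bar> \<partial>lborel) = (\<integral>\<^sup>+x. k x \<partial>lborel)"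
proof -
  have cont: "continuous_on UNIV \<phi>"
    using D by (auto intro!: continuous_at_imp_continuous_on DERIV_isCont)
  then have "strict_mono \<phi> \<or> strict_antimono_on UNIV \<phi>"
    using injective_eq_monotone_map[of UNIV \<phi>] bij by (auto simp: bij_is_inj is_interval_univ)
  then show ?thesis
  proof
    assume "strict_mono \<phi>"
    with assms show ?thesis by (intro nn_integral_strict_mono_deriv)
  next
    assume anti: "strict_antimono_on UNIV \<phi>"
    have "bij (\<lambda>x. - \<phi> x)"
    proof (rule bij_betw_byWitness[where f'="\<lambda>y. inv_into UNIV \<phi> (- y)"])
    qed (use bij in \<open>auto simp: bij_is_surj surj_f_inv_f bij_is_inj\<close>)
    moreover have "strict_mono (\<lambda>x. - \<phi> x)"
      using anti by (auto simp: monotone_on_def)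
    ultimately have "(\<integral>\<^sup>+x. k (- (- \<phi> x)) * ennreal \<bar>- \<phi>' x\<bar> \<partial>lborel) = (\<integral>\<^sup>+x. k (- x) \<partial>lborel)"
      by (intro nn_integral_strict_mono_deriv[where k="\<lambda>x. k (- x)"])
        (use D in \<open>auto intro!: derivative_intros\<close>)
    also have "\<dots> = (\<integral>\<^sup>+x. k x \<partial>lborel)"
      using nn_integral_real_affine[of k "-1" 0] by simp
    finally show ?thesis by simp
  qed
qed

text \<open>One formula for the translations, dilations, sign changes and coordinate permutations
  used below. Each of them pulls boxes back to boxes, so uniqueness of the product measure reduces
  it to an affine substitution on each axis.\<close>

lemma nn_integral_PiM_affine:
  fixes a v :: "'i \<Rightarrow> real" and F :: "('i \<Rightarrow> real) \<Rightarrow> ennreal"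
  assumes I: "finite I" and \<pi>: "bij_betw \<pi> I I" and a: "\<And>i. i \<in> I \<Longrightarrow> a i \<noteq> 0"
    and F[measurable]: "F \<in> borel_measurable (PiM I (\<lambda>_. lborel))"
  shows "ennreal (\<Prod>i\<in>I. \<bar>a i\<bar>) * (\<integral>\<^sup>+x. F (\<lambda>i\<in>I. v i + a i * x (\<pi> i)) \<partial>PiM I (\<lambda>_. lborel))
    = (\<integral>\<^sup>+x. F x \<partial>PiM I (\<lambda>_. lborel))"
proof -
  interpret product_sigma_finite "\<lambda>_::'i. lborel :: real measure" ..
  define M where "M = PiM I (\<lambda>_. lborel :: real measure)"
  have [measurable]: "F \<in> borel_measurable M" by (simp add: M_def)
  define T :: "('i \<Rightarrow> real) \<Rightarrow> 'i \<Rightarrow> real" where "T x = (\<lambda>i\<in>I. v i + a i * x (\<pi> i))" for x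
  have \<pi>I: "\<pi> i \<in> I" if "i \<in> I" for i using \<pi> that by (auto simp: bij_betw_def)
  have [measurable]: "(\<lambda>x. x j) \<in> borel_measurable M" if "j \<in> I" for j
    unfolding M_def using measurable_component_singleton[OF that, of "\<lambda>_. lborel :: real measure"]
    by simp
  have T[measurable]: "T \<in> M \<rightarrow>\<^sub>M M"
    unfolding T_def by (subst (2) M_def) (intro measurable_restrict, simp add: \<pi>I)
  define c where "c = ennreal (\<Prod>i\<in>I. \<bar>a i\<bar>)"
  define P where "P = density (distr M M T) (\<lambda>_. c)"
  have "P = PiM I (\<lambda>_. lborel)"
  proof (rule PiM_eqI[OF I])
    show "sets P = sets (PiM I (\<lambda>_. lborel))" by (simp add: P_def M_def)
    fix A :: "'i \<Rightarrow> real set" assume A: "\<And>i. i \<in> I \<Longrightarrow> A i \<in> sets lborel"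
    then have AM: "Pi\<^sub>E I A \<in> sets M" unfolding M_def using I by (intro sets_PiM_I_finite) auto
    define \<pi>' where "\<pi>' = the_inv_into I \<pi>"
    have \<pi>': "\<pi>' (\<pi> i) = i" if "i \<in> I" for i
      using \<pi> that by (auto simp: \<pi>'_def bij_betw_def the_inv_into_f_f)
    \<comment> \<open>Coordinate \<open>j\<close> of the argument feeds coordinate
      \<open>\<pi>' j\<close> of the value, so this is the side in direction \<open>j\<close> of the
      preimage of the box.\<close>
    define B where "B j = (\<lambda>y. v (\<pi>' j) + a (\<pi>' j) * y) -` A (\<pi>' j)" for j
    have B\<pi>: "B (\<pi> i) = (\<lambda>y. v i + a i * y) -` A i" if "i \<in> I" for i
      using that by (simp add: B_def \<pi>')
    have B\<pi>m: "B (\<pi> i) \<in> sets lborel" if "i \<in> I" for i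
    proof -
      have [measurable]: "A i \<in> sets borel" using A[OF that] by simp
      have "(\<lambda>y. v i + a i * y) -` A i \<inter> space borel \<in> sets borel" by measurable
      then show ?thesis by (simp add: B\<pi>[OF that])
    qed
    have Bm: "B j \<in> sets lborel" if "j \<in> I" for j
      using B\<pi>m[of "\<pi>' j"] that \<pi> 
      by (metis bij_betw_def \<pi>'_def f_the_inv_into_f the_inv_into_into subset_refl)
    have vim: "T -` Pi\<^sub>E I A \<inter> space M = Pi\<^sub>E I B"
    proof (intro Set.set_eqI iffI)
      fix x assume "x \<in> T -` Pi\<^sub>E I A \<inter> space M"
      then have x: "x \<in> extensional I" "\<And>i. i \<in> I \<Longrightarrow> v i + a i * x (\<pi> i) \<in> A i"
        by (auto simp: T_def M_def space_PiM PiE_iff)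
      show "x \<in> Pi\<^sub>E I B"
      proof (rule PiE_I)
        fix j assume "j \<in> I"
        then obtain i where "i \<in> I" "j = \<pi> i" using \<pi> by (auto simp: bij_betw_def)
        then show "x j \<in> B j" using x(2)[of i] B\<pi>[of i] by simp
      qed (use x(1) in \<open>auto simp: extensional_def\<close>)
    next
      fix x assume x: "x \<in> Pi\<^sub>E I B"
      have "v i + a i * x (\<pi> i) \<in> A i" if "i \<in> I" for i
        using PiE_mem[OF x \<pi>I[OF that]] B\<pi>[OF that] by simp
      with x show "x \<in> T -` Pi\<^sub>E I A \<inter> space M"
        by (auto simp: T_def M_def space_PiM PiE_iff)
    qed
    have A_eq: "emeasure lborel (A i) = ennreal \<bar>a i\<bar> * emeasure lborel (B (\<pi> i))" if i: "i \<in> I" for i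
    proof -
      have [measurable]: "A i \<in> sets borel" using A[OF i] by simp
      have "emeasure lborel (A i) = (\<integral>\<^sup>+y. indicator (A i) y \<partial>lborel)" by simp
      also have "\<dots> = ennreal \<bar>a i\<bar> * (\<integral>\<^sup>+y. indicator (A i) (v i + a i * y) \<partial>lborel)"
        using a[OF i] by (intro nn_integral_real_affine) auto
      also have "(\<integral>\<^sup>+y. indicator (A i) (v i + a i * y) \<partial>lborel)
          = (\<integral>\<^sup>+y. indicator (B (\<pi> i)) y \<partial>lborel)"
        by (intro nn_integral_cong) (simp add: B\<pi>[OF i] indicator_def)
      also have "\<dots> = emeasure lborel (B (\<pi> i))" using B\<pi>m[OF i] by simp
      finally show ?thesis .
    qed
    have "emeasure P (Pi\<^sub>E I A) = c * emeasure M (Pi\<^sub>E I B)"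
      using AM by (simp add: P_def emeasure_density emeasure_distr nn_integral_cmult vim[symmetric])
    also have "emeasure M (Pi\<^sub>E I B) = (\<Prod>j\<in>I. emeasure lborel (B j))"
      unfolding M_def using I Bm by (intro emeasure_PiM) auto
    also have "\<dots> = (\<Prod>i\<in>I. emeasure lborel (B (\<pi> i)))"
      using prod.reindex_bij_betw[OF \<pi>, of "\<lambda>j. emeasure lborel (B j)"] by simp
    also have "c * \<dots> = (\<Prod>i\<in>I. ennreal \<bar>a i\<bar> * emeasure lborel (B (\<pi> i)))"
      by (simp add: c_def prod.distrib prod_ennreal)
    finally show "emeasure P (Pi\<^sub>E I A) = (\<Prod>i\<in>I. emeasure lborel (A i))"
      by (simp add: A_eq)
  qed
  then have "(\<integral>\<^sup>+x. F x \<partial>PiM I (\<lambda>_. lborel)) = (\<integral>\<^sup>+x. F x \<partial>P)" by simp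
  also have "\<dots> = c * (\<integral>\<^sup>+x. F (T x) \<partial>M)"
    unfolding P_def by (simp add: nn_integral_density nn_integral_distr nn_integral_cmult)
  finally show ?thesis
    by (simp add: T_def c_def M_def)
qed

section \<open>Planar maps: measurability, inverse and substitution\<close>

lemma measurable_lebn_component [measurable]:
  "i < d \<Longrightarrow> (\<lambda>z. z i) \<in> borel_measurable (lebn d)"
  unfolding lebn_def
  using measurable_component_singleton[of i "{..<d}" "\<lambda>_. lborel :: real measure"] by simp

lemma borel_measurable_dotn [measurable]: "dotn d w \<in> borel_measurable (lebn d)"
  unfolding dotn_def by measurable

lemma borel_measurable_normn [measurable]: "normn d \<in> borel_measurable (lebn d)"
  unfolding L2_set_def by measurable

lemma measurable_lebn_restrict:
  assumes "\<And>i. i < d \<Longrightarrow> (\<lambda>z. f z i) \<in> borel_measurable M"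
  shows "(\<lambda>z. \<lambda>i\<in>{..<d}. f z i) \<in> M \<rightarrow>\<^sub>M lebn d"
  unfolding lebn_def by (intro measurable_restrict) (use assms in simp)

lemma measurable_planar_map [measurable]:
  assumes [measurable]: "h \<in> borel_measurable borel"
  shows "planar_map d u w b h \<in> lebn d \<rightarrow>\<^sub>M lebn d"
  unfolding planar_map_def[abs_def] by (intro measurable_lebn_restrict) measurable

lemma planar_map_in_Rn [simp]: "planar_map d u w b h z \<in> Rn d"
  by (simp add: planar_map_def Rn_def)

lemma dotn_planar_map:
  "dotn d w (planar_map d u w b h z) = dotn d w z + dotn d w u * h (dotn d w z + b)"
  by (simp add: dotn_def planar_map_def algebra_simps sum.distrib sum_distrib_right)

lemma dotn_surj:
  assumes "i < d" "w i \<noteq> 0"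
  obtains z where "z \<in> Rn d" "dotn d w z = s"
proof
  let ?z = "\<lambda>j\<in>{..<d}. if j = i then s / w i else 0"
  show "?z \<in> Rn d" by (simp add: Rn_def)
  have "dotn d w ?z = (\<Sum>j<d. if j = i then s else 0)"
    unfolding dotn_def using assms(2) by (intro sum.cong) auto
  then show "dotn d w ?z = s" using assms(1) by simp
qed

lemma Rn_eqI:
  assumes "x \<in> Rn d" "y \<in> Rn d" "\<And>i. i < d \<Longrightarrow> x i = y i"
  shows "x = y"
  using assms unfolding Rn_def by (intro PiE_ext) auto

text \<open>The flow acts on the scalar coordinate \<open>dotn d w z + b\<close> through this map.
  Since \<open>w\<close> is nonzero every real value occurs as a scalar coordinate, so injectivity
  and surjectivity descend from the flow.\<close>

lemma planar_map_bij_imp_bij: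
  assumes f: "bij_betw (planar_map d u w b h) (Rn d) (Rn d)" and i: "i < d" "w i \<noteq> 0"
  shows "bij (\<lambda>s. s + dotn d w u * h s)"
proof (rule bijI)
  show "inj (\<lambda>s. s + dotn d w u * h s)"
  proof (rule injI)
    fix s1 s2 assume eq: "s1 + dotn d w u * h s1 = s2 + dotn d w u * h s2"
    obtain z1 where z1: "z1 \<in> Rn d" "dotn d w z1 = s1 - b"
      using dotn_surj[of i d w "s1 - b"] i by auto
    \<comment> \<open>Sliding \<open>z1\<close> along \<open>u\<close> compensates the difference of
      the \<open>h\<close> values: \<open>z2\<close> gets the scalar coordinate \<open>s2\<close>
      and the same image as \<open>z1\<close>.\<close>
    define z2 where "z2 = (\<lambda>j\<in>{..<d}. z1 j + u j * (h s1 - h s2))"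
    have z2: "z2 \<in> Rn d" by (simp add: z2_def Rn_def)
    have "dotn d w z2 = dotn d w z1 + dotn d w u * (h s1 - h s2)"
      by (simp add: z2_def dotn_def distrib_left sum.distrib sum_distrib_right mult.assoc)
    then have dz2: "dotn d w z2 = s2 - b"
      using z1(2) eq by (simp add: algebra_simps)
    have "planar_map d u w b h z1 = planar_map d u w b h z2"
      unfolding planar_map_def using z1(2) dz2
      by (auto simp: z2_def fun_eq_iff algebra_simps)
    then have "z1 = z2"
      using f z1(1) z2 by (auto simp: bij_betw_def inj_on_def)
    then show "s1 = s2" using z1(2) dz2 by simp
  qed
  show "surj (\<lambda>s. s + dotn d w u * h s)"
    unfolding surj_def
  proof
    fix s obtain y where y: "y \<in> Rn d" "dotn d w y = s - b"
      using dotn_surj[of i d w "s - b"] i by auto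
    then obtain z where z: "z \<in> Rn d" "y = planar_map d u w b h z"
      using f by (auto simp: bij_betw_def image_iff)
    then have "s = (dotn d w z + b) + dotn d w u * h (dotn d w z + b)"
      using y(2) by (simp add: dotn_planar_map)
    then show "\<exists>x. s = x + dotn d w u * h x" by blast
  qed
qed

lemma borel_measurable_inv_into_continuous:
  fixes \<phi> :: "real \<Rightarrow> real"
  assumes "bij \<phi>" "continuous_on UNIV \<phi>"
  shows "inv_into UNIV \<phi> \<in> borel_measurable borel"
proof -
  let ?\<psi> = "inv_into UNIV \<phi>"
  have inv: "\<phi> (?\<psi> y) = y" for y
    using assms by (auto simp: bij_is_surj surj_f_inv_f)
  have "strict_mono \<phi> \<or> strict_antimono_on UNIV \<phi>"
    using injective_eq_monotone_map[of UNIV \<phi>] assms by (auto simp: bij_is_inj)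
  then show ?thesis
  proof
    assume m: "strict_mono \<phi>"
    have "mono ?\<psi>"
      by (rule monoI) (use strict_mono_less_eq[OF m] inv in metis)
    then show ?thesis by (rule borel_measurable_mono)
  next
    assume m: "strict_antimono_on UNIV \<phi>"
    have "mono (\<lambda>y. - ?\<psi> y)"
    proof (rule monoI)
      fix x y :: real assume "x \<le> y"
      have "\<not> ?\<psi> x < ?\<psi> y"
      proof
        assume "?\<psi> x < ?\<psi> y"
        then have "\<phi> (?\<psi> y) < \<phi> (?\<psi> x)" using m by (simp add: monotone_on_def)
        with inv \<open>x \<le> y\<close> show False by simp
      qed
      then show "- ?\<psi> x \<le> - ?\<psi> y" by simp
    qed
    then have "(\<lambda>y. - ?\<psi> y) \<in> borel_measurable borel" by (rule borel_measurable_mono)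
    then have "(\<lambda>y. - (- ?\<psi> y)) \<in> borel_measurable borel" by (rule borel_measurable_uminus)
    then show ?thesis by (simp only: minus_minus)
  qed
qed

text \<open>A flow moves points along \<open>u\<close> by an amount that can be recovered from the
  scalar coordinate of the image. So the inverse is planar with the same \<open>u\<close>,
  \<open>w\<close>, \<open>b\<close>, and \<open>k\<close> is \<open>- h\<close> after the inverse
  of the scalar map, or a constant if \<open>w\<close> vanishes. This explicit form is what makes
  pushed densities measurable.\<close>

lemma the_inv_planar_map:
  assumes f: "bij_betw (planar_map d u w b h) (Rn d) (Rn d)" and h: "continuous_on UNIV h"
  obtains k where "k \<in> borel_measurable borel"
    "\<And>y. y \<in> Rn d \<Longrightarrow> the_inv_into (Rn d) (planar_map d u w b h) y = planar_map d u w b k y"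
proof -
  let ?f = "planar_map d u w b h"
  define \<phi> where "\<phi> s = s + dotn d w u * h s" for s
  have [measurable]: "h \<in> borel_measurable borel"
    using h by (rule borel_measurable_continuous_onI)
  have "\<exists>k\<in>borel_measurable borel. \<forall>z\<in>Rn d. k (dotn d w (?f z) + b) = - h (dotn d w z + b)"
  proof (cases "\<exists>i<d. w i \<noteq> 0")
    case True
    then obtain i where "i < d" "w i \<noteq> 0" by blast
    then have bij: "bij \<phi>"
      using planar_map_bij_imp_bij[OF f] by (simp add: \<phi>_def[abs_def])
    have [measurable]: "inv_into UNIV \<phi> \<in> borel_measurable borel"
      using bij by (rule borel_measurable_inv_into_continuous)
        (auto simp: \<phi>_def[abs_def] intro!: continuous_intros h)
    show ?thesis
    proof (rule bexI)
      show "(\<lambda>s. - h (inv_into UNIV \<phi> s)) \<in> borel_measurable borel" by measurable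
      have "inv_into UNIV \<phi> (\<phi> s) = s" for s using bij by (simp add: bij_is_inj)
      from this[of "dotn d w z + b" for z]
      show "\<forall>z\<in>Rn d. - h (inv_into UNIV \<phi> (dotn d w (?f z) + b)) = - h (dotn d w z + b)"
        by (simp add: dotn_planar_map \<phi>_def algebra_simps)
    qed
  next
    case False
    then have "dotn d w z = 0" for z by (auto simp: dotn_def)
    then show ?thesis by (intro bexI[of _ "\<lambda>_. - h b"]) auto
  qed
  then obtain k where k: "k \<in> borel_measurable borel"
    "\<And>z. z \<in> Rn d \<Longrightarrow> k (dotn d w (?f z) + b) = - h (dotn d w z + b)" by blast
  have "the_inv_into (Rn d) ?f y = planar_map d u w b k y" if "y \<in> Rn d" for y
  proof -
    obtain z where z: "z \<in> Rn d" "y = ?f z"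
      using f \<open>y \<in> Rn d\<close> by (auto simp: bij_betw_def image_iff)
    have "planar_map d u w b k (?f z) = z"
    proof (rule Rn_eqI)
      fix i assume "i < d"
      then show "planar_map d u w b k (?f z) i = z i"
        using k(2)[OF z(1)] by (simp add: planar_map_def[of _ _ _ _ k] planar_map_def[of _ _ _ _ h z])
    qed (use z in auto)
    moreover have "the_inv_into (Rn d) ?f (?f z) = z"
      using f z by (intro the_inv_into_f_f) (auto simp: bij_betw_def)
    ultimately show ?thesis using z by simp
  qed
  with k(1) show ?thesis by (rule that)
qed

text \<open>Replace a coordinate \<open>i\<close> with \<open>w i \<noteq> 0\<close> by
  \<open>s = dotn d w z + b\<close>. In the coordinates \<open>(x, s)\<close> the flow translates
  \<open>x\<close> by an amount depending on \<open>s\<close> alone and sends \<open>s\<close> to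
  \<open>\<phi> s\<close>. Integration over \<open>x\<close> removes the translation, and
  integration over \<open>s\<close> is the scalar substitution, whose factor \<open>\<phi>'\<close>
  is the Jacobian.\<close>

lemma nn_integral_planar_map:
  fixes G :: "(nat \<Rightarrow> real) \<Rightarrow> ennreal"
  assumes f: "bij_betw (planar_map d u w b h) (Rn d) (Rn d)"
    and h: "\<And>x. (h has_real_derivative h' x) (at x)"
    and G[measurable]: "G \<in> borel_measurable (lebn d)"
  shows "(\<integral>\<^sup>+z. G (planar_map d u w b h z) * ennreal \<bar>1 + dotn d w u * h' (dotn d w z + b)\<bar> \<partial>lebn d)
    = (\<integral>\<^sup>+z. G z \<partial>lebn d)"
proof (cases "\<exists>i<d. w i \<noteq> 0")
  case False
  then have 0: "dotn d w z = 0" for z by (auto simp: dotn_def)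
  have "(\<integral>\<^sup>+z. G (planar_map d u w b h z) \<partial>lebn d)
      = ennreal (\<Prod>i\<in>{..<d}. \<bar>1\<bar>) * (\<integral>\<^sup>+z. G (\<lambda>i\<in>{..<d}. u i * h b + 1 * z (id i)) \<partial>lebn d)"
    by (simp add: planar_map_def 0 add.commute)
  also have "\<dots> = (\<integral>\<^sup>+z. G z \<partial>lebn d)"
    unfolding lebn_def
    by (rule nn_integral_PiM_affine[OF finite_lessThan bij_betw_id]) (use G in \<open>auto simp: lebn_def\<close>)
  finally show ?thesis by (simp add: 0)
next
  case True
  then obtain i where i: "i < d" "w i \<noteq> 0" by blast
  interpret product_sigma_finite "\<lambda>_::nat. lborel :: real measure" ..
  define J where "J = {..<d} - {i}"
  have J: "finite J" "i \<notin> J" "insert i J = {..<d}" using i by (auto simp: J_def)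
  define M where "M = PiM J (\<lambda>_. lborel :: real measure)"
  interpret finite_product_sigma_finite "\<lambda>_. lborel :: real measure" J by standard (rule J)
  interpret P: pair_sigma_finite M "lborel :: real measure"
    unfolding M_def by standard
  define \<phi> where "\<phi> s = s + dotn d w u * h s" for s
  define \<phi>' where "\<phi>' s = 1 + dotn d w u * h' s" for s
  have bij: "bij \<phi>"
    using planar_map_bij_imp_bij[OF f i] by (simp add: \<phi>_def[abs_def])
  have D: "(\<phi> has_real_derivative \<phi>' x) (at x)" for x
    unfolding \<phi>_def[abs_def] \<phi>'_def by (auto intro!: derivative_eq_intros h)
  have [measurable]: "h' \<in> borel_measurable borel"
    by (rule borel_measurable_real_derivative[OF h])
  have [measurable]: "h \<in> borel_measurable borel"
    using h by (intro borel_measurable_continuous_onI)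
      (auto intro!: continuous_at_imp_continuous_on DERIV_isCont)
  have [measurable]: "\<phi> \<in> borel_measurable borel" "\<phi>' \<in> borel_measurable borel"
    unfolding \<phi>_def[abs_def] \<phi>'_def[abs_def] by measurable
  have comp[measurable]: "(\<lambda>x. x j) \<in> borel_measurable M" if "j \<in> J" for j
    unfolding M_def using measurable_component_singleton[OF that, of "\<lambda>_. lborel :: real measure"]
    by simp
  define D0 where "D0 x = (\<Sum>j\<in>J. w j * x j)" for x :: "nat \<Rightarrow> real"
  have [measurable]: "D0 \<in> borel_measurable M" unfolding D0_def by measurable
  have dot: "dotn d v x = (\<Sum>j\<in>J. v j * x j) + v i * x i" for v x
    unfolding dotn_def J(3)[symmetric] using J(1,2) by (simp add: add.commute)
  have upd[measurable]: "(\<lambda>y. (g y)(i := t y)) \<in> N \<rightarrow>\<^sub>M lebn d"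
    if "g \<in> N \<rightarrow>\<^sub>M M" "t \<in> borel_measurable N" for g t and N :: "'a measure"
    unfolding lebn_def J(3)[symmetric] using that
    by (intro measurable_fun_upd[where J=J]) (auto simp: M_def)
  define T where "T s x = (\<lambda>j\<in>J. u j * h s + 1 * x (id j))" for s x
  have T[measurable]: "(\<lambda>(x, s). T s x) \<in> M \<Otimes>\<^sub>M lborel \<rightarrow>\<^sub>M M"
    unfolding T_def by (subst (2) M_def) (auto simp: split_beta intro!: measurable_restrict)
  \<comment> \<open>\<open>?K x s\<close> evaluates \<open>G\<close> at the point with coordinates
    \<open>x\<close> off \<open>i\<close> and scalar coordinate \<open>s\<close>; \<open>?H\<close>
    is the integrand of the left-hand side.\<close>
  let ?K = "\<lambda>x s. G (x(i := (s - D0 x - b) / w i))"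
  let ?H = "\<lambda>z. G (planar_map d u w b h z) * ennreal \<bar>\<phi>' (dotn d w z + b)\<bar>"
  have K[measurable]: "(\<lambda>(x, s). ?K x s) \<in> borel_measurable (M \<Otimes>\<^sub>M lborel)"
    by (simp add: split_beta)
  have planar: "?H (x(i := - (D0 x + b) / w i + 1 / w i * s)) = ?K (T s x) (\<phi> s) * ennreal \<bar>\<phi>' s\<bar>"
    if "x \<in> space M" for x s
  proof -
    define t where "t = - (D0 x + b) / w i + 1 / w i * s"
    have wt: "w i * t = s - D0 x - b" using i by (simp add: t_def field_simps)
    have "dotn d w (x(i := t)) = D0 x + w i * t"
      unfolding dot D0_def using J(2) by (auto intro!: sum.cong)
    then have s: "dotn d w (x(i := t)) + b = s" using wt by simp
    have D0T: "D0 (T s x) = D0 x + (dotn d w u - w i * u i) * h s"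
      by (simp add: D0_def T_def dot distrib_left sum.distrib sum_distrib_right mult.assoc)
    have "planar_map d u w b h (x(i := t)) = (T s x)(i := (\<phi> s - D0 (T s x) - b) / w i)"
    proof (rule Rn_eqI)
      fix j assume j: "j < d"
      show "planar_map d u w b h (x(i := t)) j = ((T s x)(i := (\<phi> s - D0 (T s x) - b) / w i)) j"
      proof (cases "j = i")
        case True
        have "(\<phi> s - D0 (T s x) - b) / w i = t + u i * h s"
          using i wt by (simp add: D0T \<phi>_def field_simps)
        then show ?thesis using True j by (simp add: planar_map_def s)
      next
        case False
        then show ?thesis using j by (simp add: planar_map_def s T_def J_def)
      qed
    qed (simp, use i in \<open>auto simp: Rn_def T_def PiE_iff extensional_def J_def\<close>)
    then show ?thesis by (simp only: t_def[symmetric] s)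
  qed
  have "(\<integral>\<^sup>+z. ?H z \<partial>lebn d) = (\<integral>\<^sup>+x. \<integral>\<^sup>+t. ?H (x(i := t)) \<partial>lborel \<partial>M)"
    unfolding lebn_def M_def J(3)[symmetric]
    by (rule product_nn_integral_insert) (use J in \<open>auto simp: lebn_def[symmetric]\<close>)
  also have "\<dots> = (\<integral>\<^sup>+x. ennreal \<bar>1 / w i\<bar> * (\<integral>\<^sup>+s. ?K (T s x) (\<phi> s) * ennreal \<bar>\<phi>' s\<bar> \<partial>lborel) \<partial>M)"
  proof (rule nn_integral_cong)
    fix x assume x[measurable]: "x \<in> space M"
    have "(\<lambda>t. ?H (x(i := t))) \<in> borel_measurable borel" by measurable
    then have "(\<integral>\<^sup>+t. ?H (x(i := t)) \<partial>lborel) = ennreal \<bar>1 / w i\<bar> *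
        (\<integral>\<^sup>+s. ?H (x(i := - (D0 x + b) / w i + 1 / w i * s)) \<partial>lborel)"
      using i by (intro nn_integral_real_affine) auto
    then show "(\<integral>\<^sup>+t. ?H (x(i := t)) \<partial>lborel) = ennreal \<bar>1 / w i\<bar> *
        (\<integral>\<^sup>+s. ?K (T s x) (\<phi> s) * ennreal \<bar>\<phi>' s\<bar> \<partial>lborel)"
      by (simp only: planar[OF x])
  qed
  also have "\<dots> = ennreal \<bar>1 / w i\<bar> * (\<integral>\<^sup>+x. \<integral>\<^sup>+s. ?K (T s x) (\<phi> s) * ennreal \<bar>\<phi>' s\<bar> \<partial>lborel \<partial>M)"
    by (rule nn_integral_cmult) measurable
  \<comment> \<open>For fixed \<open>s\<close> the map \<open>T s\<close> is a translation of the
    remaining coordinates. The order of integration is exchanged to remove it, and exchanged back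
    for the substitution in \<open>s\<close>.\<close>
  also have "(\<integral>\<^sup>+x. \<integral>\<^sup>+s. ?K (T s x) (\<phi> s) * ennreal \<bar>\<phi>' s\<bar> \<partial>lborel \<partial>M)
      = (\<integral>\<^sup>+s. \<integral>\<^sup>+x. ?K (T s x) (\<phi> s) * ennreal \<bar>\<phi>' s\<bar> \<partial>M \<partial>lborel)"
    by (rule P.Fubini'[symmetric]) measurable
  also have "\<dots> = (\<integral>\<^sup>+s. \<integral>\<^sup>+x. ?K x (\<phi> s) * ennreal \<bar>\<phi>' s\<bar> \<partial>M \<partial>lborel)"
  proof (rule nn_integral_cong)
    fix s :: real
    have "(\<integral>\<^sup>+x. ?K x (\<phi> s) * ennreal \<bar>\<phi>' s\<bar> \<partial>M)
      = ennreal (\<Prod>j\<in>J. \<bar>1\<bar>) * (\<integral>\<^sup>+x. ?K (T s x) (\<phi> s) * ennreal \<bar>\<phi>' s\<bar> \<partial>M)"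
      unfolding M_def T_def
      by (rule nn_integral_PiM_affine[OF J(1) bij_betw_id, symmetric]) (use J in \<open>auto simp: M_def[symmetric]\<close>)
    then show "(\<integral>\<^sup>+x. ?K (T s x) (\<phi> s) * ennreal \<bar>\<phi>' s\<bar> \<partial>M) = (\<integral>\<^sup>+x. ?K x (\<phi> s) * ennreal \<bar>\<phi>' s\<bar> \<partial>M)"
      by simp
  qed
  also have "\<dots> = (\<integral>\<^sup>+x. \<integral>\<^sup>+s. ?K x (\<phi> s) * ennreal \<bar>\<phi>' s\<bar> \<partial>lborel \<partial>M)"
    by (rule P.Fubini') measurable
  also have "ennreal \<bar>1 / w i\<bar> * \<dots> = (\<integral>\<^sup>+x. ennreal \<bar>1 / w i\<bar> * (\<integral>\<^sup>+s. ?K x (\<phi> s) * ennreal \<bar>\<phi>' s\<bar> \<partial>lborel) \<partial>M)"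
    by (rule nn_integral_cmult[symmetric]) measurable
  also have "\<dots> = (\<integral>\<^sup>+x. \<integral>\<^sup>+t. G (x(i := t)) \<partial>lborel \<partial>M)"
  proof (rule nn_integral_cong)
    fix x assume x[measurable]: "x \<in> space M"
    have "(\<integral>\<^sup>+s. ?K x (\<phi> s) * ennreal \<bar>\<phi>' s\<bar> \<partial>lborel) = (\<integral>\<^sup>+s. ?K x s \<partial>lborel)"
      by (rule nn_integral_bij_deriv[OF bij D]) measurable
    also have "\<dots> = (\<integral>\<^sup>+s. G (x(i := - (D0 x + b) / w i + 1 / w i * s)) \<partial>lborel)"
      by (simp add: diff_divide_distrib add_divide_distrib algebra_simps)
    also have "ennreal \<bar>1 / w i\<bar> * \<dots> = (\<integral>\<^sup>+t. G (x(i := t)) \<partial>lborel)"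
      using i by (intro nn_integral_real_affine[symmetric]) auto
    finally show "ennreal \<bar>1 / w i\<bar> * (\<integral>\<^sup>+s. ?K x (\<phi> s) * ennreal \<bar>\<phi>' s\<bar> \<partial>lborel)
        = (\<integral>\<^sup>+t. G (x(i := t)) \<partial>lborel)" .
  qed
  also have "\<dots> = (\<integral>\<^sup>+z. G z \<partial>lebn d)"
    unfolding lebn_def M_def J(3)[symmetric]
    by (rule product_nn_integral_insert[symmetric]) (use J in \<open>auto simp: lebn_def[symmetric]\<close>)
  finally show ?thesis by (simp add: \<phi>'_def)
qed

section \<open>Transport of densities by planar flows\<close>

text \<open>The matrix determinant lemma. The block matrix with diagonal blocks \<open>?I\<close>,
  \<open>?O\<close> and off-diagonal blocks \<open>U\<close>, \<open>- W\<close> is brought to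
  triangular form in two ways; the two Schur complements are \<open>?I + U * W\<close> and the
  one-by-one matrix \<open>W * U + ?O\<close>.\<close>

lemma det_one_plus_rank_one:
  fixes u w :: "nat \<Rightarrow> real"
  shows "Determinant.det (mat d d (\<lambda>(i, j). (if i = j then 1 else 0) + u i * w j)) = 1 + (\<Sum>i<d. w i * u i)"
proof -
  define U where "U = mat d 1 (\<lambda>(i, j). u i)"
  define W where "W = mat 1 d (\<lambda>(i, j). w j)"
  have U: "U \<in> carrier_mat d 1" and W: "W \<in> carrier_mat 1 d" by (auto simp: U_def W_def)
  have UW: "U * W \<in> carrier_mat d d" and WU: "W * U \<in> carrier_mat 1 1" using U W by auto
  let ?O = "1\<^sub>m 1 :: real mat" and ?I = "1\<^sub>m d :: real mat"
  let ?Z = "0\<^sub>m d 1 :: real mat" and ?Z' = "0\<^sub>m 1 d :: real mat"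
  have "four_block_mat (?I + U * W) U ?Z' ?O * four_block_mat ?I ?Z (- W) ?O = four_block_mat ?I U (- W) ?O"
    by (subst mult_four_block_mat[of _ d d _ 1 _ 1 _ _ d _ 1])
       (use U W UW in \<open>auto simp: add_uminus_minus_mat[symmetric] intro!: arg_cong4[where f=four_block_mat] eq_matI\<close>)
  then have "Determinant.det (four_block_mat (?I + U * W) U ?Z' ?O) * Determinant.det (four_block_mat ?I ?Z (- W) ?O)
      = Determinant.det (four_block_mat ?I U (- W) ?O)"
    by (subst det_mult[of _ "d + 1", symmetric]) (use U W UW in auto)
  moreover have "Determinant.det (four_block_mat (?I + U * W) U ?Z' ?O) = Determinant.det (?I + U * W)"
    by (subst det_four_block_mat_lower_left_zero[of _ d _ 1]) (use U UW in auto)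
  moreover have "Determinant.det (four_block_mat ?I ?Z (- W) ?O) = 1"
    by (subst det_four_block_mat_upper_right_zero[of _ d _ 1]) (use W in auto)
  moreover have "four_block_mat ?I ?Z W ?O * four_block_mat ?I U (- W) ?O = four_block_mat ?I U ?Z' (W * U + ?O)"
    by (subst mult_four_block_mat[of _ d d _ 1 _ 1 _ _ d _ 1])
       (use U W WU in \<open>auto intro!: arg_cong4[where f=four_block_mat] eq_matI\<close>)
  then have "Determinant.det (four_block_mat ?I ?Z W ?O) * Determinant.det (four_block_mat ?I U (- W) ?O)
      = Determinant.det (four_block_mat ?I U ?Z' (W * U + ?O))"
    by (subst det_mult[of _ "d + 1", symmetric]) (use U W in auto)
  moreover have "Determinant.det (four_block_mat ?I ?Z W ?O) = 1"
    by (subst det_four_block_mat_upper_right_zero[of _ d _ 1]) (use W in auto)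
  moreover have "Determinant.det (four_block_mat ?I U ?Z' (W * U + ?O)) = Determinant.det (W * U + ?O)"
    by (subst det_four_block_mat_lower_left_zero[of _ d _ 1]) (use U W in auto)
  ultimately have "Determinant.det (?I + U * W) = Determinant.det (W * U + ?O)" by simp
  also have "Determinant.det (W * U + ?O) = 1 + (\<Sum>i<d. w i * u i)"
    using det_single[of "W * U + ?O"] WU
    by (simp add: U_def W_def scalar_prod_def lessThan_atLeast0)
  also have "?I + U * W = mat d d (\<lambda>(i, j). (if i = j then 1 else 0) + u i * w j)"
    by (rule eq_matI) (auto simp: U_def W_def scalar_prod_def)
  finally show ?thesis .
qed

text \<open>The invariant of compositions under which their \<open>jacobian\<close> obeys the chain
  rule. A planar map is the identity plus a scalar function of a linear form, so applying it after a
  curve needs only the componentwise derivatives of that curve, and coordinate lines are such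
  curves.\<close>

definition partially_diff :: "nat \<Rightarrow> ((nat \<Rightarrow> real) \<Rightarrow> (nat \<Rightarrow> real)) \<Rightarrow> bool" where
  "partially_diff d g \<longleftrightarrow> (\<forall>z\<in>Rn d. g z \<in> Rn d \<and>
     (\<forall>i<d. \<forall>j<d. (\<lambda>t. g (z(j := t)) i) differentiable (at (z j))))"

lemma DERIV_planar_map:
  assumes h: "\<And>x. (h has_real_derivative h' x) (at x)"
    and \<gamma>: "\<And>k. k < d \<Longrightarrow> ((\<lambda>t. \<gamma> t k) has_real_derivative D k) (at t)"
    and i: "i < d"
  shows "((\<lambda>t. planar_map d u w b h (\<gamma> t) i) has_real_derivative
    D i + u i * (h' (dotn d w (\<gamma> t) + b) * dotn d w D)) (at t)"
proof -
  have "((\<lambda>t. dotn d w (\<gamma> t) + b) has_real_derivative dotn d w D) (at t)"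
    unfolding dotn_def by (auto intro!: derivative_eq_intros \<gamma> simp: mult.commute)
  from DERIV_chain2[OF h this] \<gamma>[OF i] i show ?thesis
    unfolding planar_map_def by (auto intro!: derivative_eq_intros)
qed

lemma jacobian_planar_map:
  assumes h: "\<And>x. (h has_real_derivative h' x) (at x)"
  shows "jacobian d (planar_map d u w b h) z =
    mat d d (\<lambda>(i, j). (if i = j then 1 else 0) + u i * (h' (dotn d w z + b) * w j))"
  unfolding jacobian_def
proof (rule cong_mat, safe)
  fix i j assume ij: "i < d" "j < d"
  have "((\<lambda>t. planar_map d u w b h (z(j := t)) i) has_real_derivative
      (if i = j then 1 else 0) + u i * (h' (dotn d w (z(j := z j)) + b) * dotn d w (\<lambda>k. if k = j then 1 else 0)))
      (at (z j))"
    using ij by (intro DERIV_planar_map h) (auto intro!: derivative_eq_intros)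
  moreover have "dotn d w (\<lambda>k. if k = j then 1 else 0) = w j"
    using ij by (simp add: dotn_def if_distrib[where f="\<lambda>x. _ * x"] cong: if_cong)
  ultimately show "gradn d (\<lambda>y. planar_map d u w b h y i) z j =
      (if i = j then 1 else 0) + u i * (h' (dotn d w z + b) * w j)"
    using ij by (simp add: gradn_def DERIV_imp_deriv)
qed

lemma det_jacobian_planar_map:
  assumes "\<And>x. (h has_real_derivative h' x) (at x)"
  shows "Determinant.det (jacobian d (planar_map d u w b h) z) = 1 + dotn d w u * h' (dotn d w z + b)"
  unfolding jacobian_planar_map[OF assms] det_one_plus_rank_one
  by (simp add: dotn_def sum_distrib_left sum_distrib_right mult_ac)

lemma planar_map_comp:
  assumes h: "\<And>x. (h has_real_derivative h' x) (at x)" and g: "partially_diff d g"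
  shows "partially_diff d (planar_map d u w b h \<circ> g)"
    and "z \<in> Rn d \<Longrightarrow> jacobian d (planar_map d u w b h \<circ> g) z
      = jacobian d (planar_map d u w b h) (g z) * jacobian d g z"
proof -
  let ?f = "planar_map d u w b h"
  define D where "D z j k = deriv (\<lambda>t. g (z(j := t)) k) (z j)" for z j k
  have D: "((\<lambda>t. g (z(j := t)) k) has_real_derivative D z j k) (at (z j))"
    if "z \<in> Rn d" "j < d" "k < d" for z j k
    using g that unfolding partially_diff_def D_def by (simp add: DERIV_deriv_iff_real_differentiable)
  have F: "((\<lambda>t. (?f \<circ> g) (z(j := t)) i) has_real_derivative
      D z j i + u i * (h' (dotn d w (g z) + b) * dotn d w (D z j))) (at (z j))"
    if "z \<in> Rn d" "i < d" "j < d" for z i j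
    using DERIV_planar_map[OF h, of d "\<lambda>t. g (z(j := t))" "D z j" "z j"] D that by simp
  show "partially_diff d (?f \<circ> g)"
    unfolding partially_diff_def
  proof safe
    fix z i j assume "z \<in> Rn d" "i < d" "j < d"
    from F[OF this] show "(\<lambda>t. (?f \<circ> g) (z(j := t)) i) differentiable (at (z j))"
      by (auto simp: real_differentiable_def)
  qed simp
  assume z: "z \<in> Rn d"
  show "jacobian d (?f \<circ> g) z = jacobian d ?f (g z) * jacobian d g z"
  proof (rule eq_matI)
    fix i j assume "i < dim_row (jacobian d ?f (g z) * jacobian d g z)"
      "j < dim_col (jacobian d ?f (g z) * jacobian d g z)"
    then have ij: "i < d" "j < d" by (auto simp: jacobian_def)
    have "jacobian d (?f \<circ> g) z $$ (i, j) = D z j i + u i * (h' (dotn d w (g z) + b) * dotn d w (D z j))"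
      using ij DERIV_imp_deriv[OF F[OF z ij]] by (simp add: jacobian_def gradn_def)
    also have "\<dots> = (\<Sum>k<d. (if i = k then D z j k else 0) + u i * (h' (dotn d w (g z) + b) * (w k * D z j k)))"
      using ij by (simp add: sum.distrib dotn_def sum_distrib_left)
    also have "\<dots> = (\<Sum>k<d. ((if i = k then 1 else 0) + u i * (h' (dotn d w (g z) + b) * w k)) * D z j k)"
      by (intro sum.cong) (auto simp: algebra_simps)
    also have "\<dots> = (jacobian d ?f (g z) * jacobian d g z) $$ (i, j)"
      using ij unfolding jacobian_planar_map[OF h]
      by (simp add: scalar_prod_def jacobian_def gradn_def D_def lessThan_atLeast0)
    finally show "jacobian d (?f \<circ> g) z $$ (i, j) = (jacobian d ?f (g z) * jacobian d g z) $$ (i, j)" .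
  qed (auto simp: jacobian_def)
qed

lemma partially_diff_id: "partially_diff d id"
  unfolding partially_diff_def
proof safe
  fix z :: "nat \<Rightarrow> real" and i j :: nat
  show "(\<lambda>t. id (z(j := t)) i) differentiable (at (z j))"
    by (cases "i = j") auto
qed auto

lemma push_density_id:
  assumes "y \<in> Rn d"
  shows "push_density d id q y = q y"
proof -
  have "jacobian d id y = 1\<^sub>m d"
    by (rule eq_matI) (auto simp: jacobian_def gradn_def)
  moreover have "the_inv_into (Rn d) id y = y"
    using the_inv_into_f_f[of id "Rn d" y] assms by simp
  ultimately show ?thesis by (simp add: push_density_def)
qed

section \<open>Pushed densities and the isometry in L1\<close>

lemma local_planar_flowsE:
  assumes "f \<in> local_planar_flows d c"
  obtains u w b h h' where "f = planar_map d u w b h" "bij_betw f (Rn d) (Rn d)"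
    "\<And>x. (h has_real_derivative h' x) (at x)" "\<And>x. \<bar>h x\<bar> \<le> c" "\<And>x. \<bar>h' x\<bar> \<le> c / (1 + \<bar>x\<bar>)"
    "normn d u \<le> 1" "normn d w \<le> 1" "AE z in lebn d. 1 + dotn d w u * h' (dotn d w z + b) \<noteq> 0"
    "0 \<le> c"
proof -
  from assms obtain u w b h where f: "f = planar_map d u w b h" "normalizing_flow d f"
    and h: "local_nonlin c h" and uw: "normn d u \<le> 1" "normn d w \<le> 1"
    by (auto simp: local_planar_flows_def)
  have D: "\<And>x. (h has_real_derivative deriv h x) (at x)"
    using h by (simp add: local_nonlin_def DERIV_deriv_iff_real_differentiable)
  have hb: "\<And>x. \<bar>h x\<bar> \<le> c" "\<And>x. \<bar>deriv h x\<bar> \<le> c / (1 + \<bar>x\<bar>)"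
    using h by (auto simp: local_nonlin_def)
  have "0 \<le> c" using hb(1)[of 0] by linarith
  moreover have "AE z in lebn d. 1 + dotn d w u * deriv h (dotn d w z + b) \<noteq> 0"
    using f(2) unfolding normalizing_flow_def f(1) det_jacobian_planar_map[OF D] by blast
  ultimately show ?thesis
    using that f D hb uw unfolding normalizing_flow_def by blast
qed

text \<open>\<open>T_flow\<close> pushes the density by the whole composition at once, through its
  own inverse and Jacobian. The chain rule and the multiplicativity of the determinant split off the
  outermost layer.\<close>

lemma push_density_comp:
  assumes f: "f \<in> local_planar_flows d c" and g: "bij_betw g (Rn d) (Rn d)" "partially_diff d g"
    and y: "y \<in> Rn d"
  shows "push_density d (f \<circ> g) q y = push_density d f (push_density d g q) y"
proof -
  obtain u w b h h' where pl: "f = planar_map d u w b h" and bij: "bij_betw f (Rn d) (Rn d)"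
    and h: "\<And>x. (h has_real_derivative h' x) (at x)"
    using local_planar_flowsE[OF f] by metis
  define z where "z = the_inv_into (Rn d) g (the_inv_into (Rn d) f y)"
  have fy: "the_inv_into (Rn d) f y \<in> Rn d" 
    using bij_betwE[OF bij_betw_the_inv_into[OF bij]] y by blast
  then have z: "z \<in> Rn d" "g z = the_inv_into (Rn d) f y"
    using g unfolding z_def 
    by (auto simp: f_the_inv_into_f_bij_betw intro: bij_betwE[OF bij_betw_the_inv_into, THEN bspec])
  have "(f \<circ> g) z = y"
    using f_the_inv_into_f_bij_betw[OF bij] y z(2) by simp
  then have "the_inv_into (Rn d) (f \<circ> g) y = z"
    using the_inv_into_f_f[of "f \<circ> g" "Rn d" z] bij_betw_trans[OF g(1) bij] z(1)
    by (simp add: bij_betw_def)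
  moreover have "Determinant.det (jacobian d (f \<circ> g) z)
      = Determinant.det (jacobian d f (g z)) * Determinant.det (jacobian d g z)"
    unfolding pl planar_map_comp(2)[OF h g(2) z(1)]
    by (intro det_mult[of _ d]) (auto simp: jacobian_def)
  ultimately show ?thesis
    by (simp add: push_density_def Let_def z z_def[symmetric] abs_mult)
qed

lemma push_density_measurable:
  assumes f: "f \<in> local_planar_flows d c" and [measurable]: "q \<in> borel_measurable (lebn d)"
  shows "push_density d f q \<in> borel_measurable (lebn d)"
proof -
  obtain u w b h h' where pl: "f = planar_map d u w b h" and bij: "bij_betw f (Rn d) (Rn d)"
    and h: "\<And>x. (h has_real_derivative h' x) (at x)"
    using local_planar_flowsE[OF f] by metis
  have [measurable]: "h' \<in> borel_measurable borel"
    by (rule borel_measurable_real_derivative[OF h])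
  have "continuous_on UNIV h"
    using h by (auto intro!: continuous_at_imp_continuous_on DERIV_isCont)
  then obtain k where k[measurable]: "k \<in> borel_measurable borel"
    and inv: "\<And>y. y \<in> Rn d \<Longrightarrow> the_inv_into (Rn d) f y = planar_map d u w b k y"
    using the_inv_planar_map[OF bij[unfolded pl]] pl by metis
  have "(\<lambda>y. q (planar_map d u w b k y) / \<bar>1 + dotn d w u * h' (dotn d w (planar_map d u w b k y) + b)\<bar>)
      \<in> borel_measurable (lebn d)"
    by measurable
  then show ?thesis
    by (rule subst[OF measurable_cong, rotated])
      (simp add: space_lebn push_density_def Let_def inv[unfolded pl] pl det_jacobian_planar_map[OF h])
qed

text \<open>The substitution \<open>y = f z\<close> brings in the factor that the pushed density
  divides by; the two cancel where the determinant is nonzero, hence almost everywhere. With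
  \<open>r\<close> equal to 0 this is conservation of mass, with \<open>q\<close> and
  \<open>r\<close> both equal to \<open>p\<close> it is the displacement of \<open>p\<close> by one
  layer.\<close>

lemma nn_integral_push_density:
  assumes f: "f \<in> local_planar_flows d c"
    and q[measurable]: "q \<in> borel_measurable (lebn d)" and r[measurable]: "r \<in> borel_measurable (lebn d)"
  shows "(\<integral>\<^sup>+y. ennreal \<bar>push_density d f q y - r y\<bar> \<partial>lebn d)
    = (\<integral>\<^sup>+z. ennreal \<bar>q z - r (f z) * \<bar>Determinant.det (jacobian d f z)\<bar>\<bar> \<partial>lebn d)"
proof -
  obtain u w b h h' where pl: "f = planar_map d u w b h" and bij: "bij_betw f (Rn d) (Rn d)"
    and h: "\<And>x. (h has_real_derivative h' x) (at x)"
    and AE0: "AE z in lebn d. 1 + dotn d w u * h' (dotn d w z + b) \<noteq> 0"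
    using local_planar_flowsE[OF f] by metis
  note [measurable] = push_density_measurable[OF f q]
  note J = det_jacobian_planar_map[OF h]
  have "(\<integral>\<^sup>+y. ennreal \<bar>push_density d f q y - r y\<bar> \<partial>lebn d)
    = (\<integral>\<^sup>+z. ennreal \<bar>push_density d f q (f z) - r (f z)\<bar>
        * ennreal \<bar>1 + dotn d w u * h' (dotn d w z + b)\<bar> \<partial>lebn d)"
    unfolding pl by (rule nn_integral_planar_map[OF bij[unfolded pl] h, symmetric])
      (simp add: pl[symmetric])
  also have "\<dots> = (\<integral>\<^sup>+z. ennreal \<bar>q z - r (f z) * \<bar>Determinant.det (jacobian d f z)\<bar>\<bar> \<partial>lebn d)"
  proof (rule nn_integral_cong_AE)
    show "AE z in lebn d. ennreal \<bar>push_density d f q (f z) - r (f z)\<bar>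
        * ennreal \<bar>1 + dotn d w u * h' (dotn d w z + b)\<bar>
      = ennreal \<bar>q z - r (f z) * \<bar>Determinant.det (jacobian d f z)\<bar>\<bar>"
      using AE0 AE_space
    proof eventually_elim
      fix z assume nz: "1 + dotn d w u * h' (dotn d w z + b) \<noteq> 0" and z: "z \<in> space (lebn d)"
      define j where "j = 1 + dotn d w u * h' (dotn d w z + b)"
      have "push_density d f q (f z) = q z / \<bar>j\<bar>"
        using z bij unfolding push_density_def
        by (simp add: pl J space_lebn the_inv_into_f_f bij_betw_def j_def)
      moreover have "\<bar>q z / \<bar>j\<bar> - r (f z)\<bar> * \<bar>j\<bar> = \<bar>(q z / \<bar>j\<bar> - r (f z)) * \<bar>j\<bar>\<bar>"
        by (simp add: abs_mult)
      moreover have "(q z / \<bar>j\<bar> - r (f z)) * \<bar>j\<bar> = q z - r (f z) * \<bar>j\<bar>"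
        using nz by (simp add: j_def left_diff_distrib)
      ultimately show "ennreal \<bar>push_density d f q (f z) - r (f z)\<bar>
          * ennreal \<bar>1 + dotn d w u * h' (dotn d w z + b)\<bar>
        = ennreal \<bar>q z - r (f z) * \<bar>Determinant.det (jacobian d f z)\<bar>\<bar>"
        by (simp add: pl J j_def ennreal_mult''[symmetric])
    qed
  qed
  finally show ?thesis .
qed

lemma integrable_push_density:
  assumes f: "f \<in> local_planar_flows d c" and q: "integrable (lebn d) q"
  shows "integrable (lebn d) (push_density d f q)"
proof (rule integrableI_bounded)
  note [measurable] = borel_measurable_integrable[OF q]
  show "push_density d f q \<in> borel_measurable (lebn d)"
    by (rule push_density_measurable[OF f]) measurable
  have "(\<integral>\<^sup>+y. ennreal \<bar>push_density d f q y\<bar> \<partial>lebn d) = (\<integral>\<^sup>+z. ennreal \<bar>q z\<bar> \<partial>lebn d)"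
    using nn_integral_push_density[OF f, of q "\<lambda>_. 0"] by simp
  also have "\<dots> < \<infinity>" using q by (simp add: integrable_iff_bounded)
  finally show "(\<integral>\<^sup>+y. ennreal (norm (push_density d f q y)) \<partial>lebn d) < \<infinity>" by simp
qed

lemma nn_integral_eq_L1_norm:
  "integrable (lebn d) g \<Longrightarrow> (\<integral>\<^sup>+z. ennreal \<bar>g z\<bar> \<partial>lebn d) = ennreal (L1_norm d g)"
  unfolding L1_norm_def by (intro nn_integral_eq_integral) auto

lemma L1_norm_nonneg [simp]: "0 \<le> L1_norm d g"
  unfolding L1_norm_def by simp

text \<open>For fixed \<open>f\<close> pushing is linear in the density, so this is conservation of
  mass for the difference, which may change sign.\<close>

lemma L1_norm_push_density_diff:
  assumes f: "f \<in> local_planar_flows d c" and q: "integrable (lebn d) q" and r: "integrable (lebn d) r"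
  shows "L1_norm d (\<lambda>y. push_density d f q y - push_density d f r y) = L1_norm d (\<lambda>z. q z - r z)"
proof -
  note [measurable] = borel_measurable_integrable[OF q] borel_measurable_integrable[OF r]
  have "push_density d f q y - push_density d f r y = push_density d f (\<lambda>z. q z - r z) y" for y
    by (simp add: push_density_def Let_def diff_divide_distrib)
  then have "(\<integral>\<^sup>+y. ennreal \<bar>push_density d f q y - push_density d f r y\<bar> \<partial>lebn d)
      = (\<integral>\<^sup>+z. ennreal \<bar>q z - r z\<bar> \<partial>lebn d)"
    using nn_integral_push_density[OF f, of "\<lambda>z. q z - r z" "\<lambda>_. 0"] by simp
  then show ?thesis
    using q r integrable_push_density[OF f q] integrable_push_density[OF f r]
    by (simp add: nn_integral_eq_L1_norm)
qed

lemma L1_norm_triangle: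
  assumes "integrable (lebn d) a" "integrable (lebn d) b" "integrable (lebn d) c"
  shows "L1_norm d (\<lambda>z. a z - c z) \<le> L1_norm d (\<lambda>z. a z - b z) + L1_norm d (\<lambda>z. b z - c z)"
proof -
  have "L1_norm d (\<lambda>z. a z - c z) \<le> (\<integral>z. \<bar>a z - b z\<bar> + \<bar>b z - c z\<bar> \<partial>lebn d)"
    unfolding L1_norm_def by (rule integral_mono) (use assms in auto)
  also have "\<dots> = L1_norm d (\<lambda>z. a z - b z) + L1_norm d (\<lambda>z. b z - c z)"
    unfolding L1_norm_def by (rule Bochner_Integration.integral_add) (use assms in auto)
  finally show ?thesis .
qed

lemma L1_norm_cong:
  "(\<And>z. z \<in> Rn d \<Longrightarrow> a z = b z) \<Longrightarrow> L1_norm d a = L1_norm d b"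
  unfolding L1_norm_def by (intro Bochner_Integration.integral_cong) (auto simp: space_lebn)

text \<open>Each flow preserves \<open>L\<^sup>1\<close> distances, so peeling off one layer costs at most
  the distance \<open>L\<close> by which a single flow can move \<open>p\<close>.\<close>

lemma L1_norm_flow_composition:
  assumes L: "\<And>f. f \<in> local_planar_flows d c \<Longrightarrow> L1_norm d (\<lambda>z. push_density d f p z - p z) \<le> L"
    and p: "integrable (lebn d) p" and q: "integrable (lebn d) q"
    and fs: "set fs \<subseteq> local_planar_flows d c"
  shows "L1_norm d (\<lambda>z. q z - p z)
    \<le> L1_norm d (\<lambda>z. push_density d (foldr (\<circ>) fs id) q z - p z) + real (length fs) * L"
proof -
  let ?g = "\<lambda>fs. foldr (\<circ>) fs id"
  \<comment> \<open>The induction also carries bijectivity, partial differentiability and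
    integrability, which splitting off a layer and the triangle inequality require.\<close>
  have "bij_betw (?g fs) (Rn d) (Rn d) \<and> partially_diff d (?g fs) \<and>
    integrable (lebn d) (push_density d (?g fs) q) \<and>
    L1_norm d (\<lambda>z. q z - p z) \<le> L1_norm d (\<lambda>z. push_density d (?g fs) q z - p z) + real (length fs) * L"
    using fs
  proof (induction fs)
    case Nil
    have "integrable (lebn d) (push_density d id q)"
      by (rule Bochner_Integration.integrable_cong[THEN iffD1, OF refl _ q])
        (simp add: space_lebn push_density_id)
    moreover have "L1_norm d (\<lambda>z. push_density d id q z - p z) = L1_norm d (\<lambda>z. q z - p z)"
      by (rule L1_norm_cong) (simp add: push_density_id)
    moreover have "?g [] = (id :: (nat \<Rightarrow> real) \<Rightarrow> nat \<Rightarrow> real)" by (rule ext) simp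
    ultimately show ?case
      using partially_diff_id bij_betw_id by (simp only: list.size of_nat_0 mult_zero_left add_0_right order.refl simp_thms)
  next
    case (Cons f fs)
    let ?q = "push_density d (?g fs) q"
    have f: "f \<in> local_planar_flows d c" using Cons.prems by simp
    have fs: "set fs \<subseteq> local_planar_flows d c" using Cons.prems by simp
    have g: "bij_betw (?g fs) (Rn d) (Rn d)" "partially_diff d (?g fs)" "integrable (lebn d) ?q"
      and IH: "L1_norm d (\<lambda>z. q z - p z) \<le> L1_norm d (\<lambda>z. ?q z - p z) + real (length fs) * L"
      using Cons.IH[OF fs] by blast+
    obtain u w b h h' where pl: "f = planar_map d u w b h" and bij: "bij_betw f (Rn d) (Rn d)"
      and h: "\<And>x. (h has_real_derivative h' x) (at x)"
      using local_planar_flowsE[OF f] by metis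
    note comp = push_density_comp[OF f g(1,2)]
    have int: "integrable (lebn d) (push_density d (f \<circ> ?g fs) q)"
      by (rule Bochner_Integration.integrable_cong[THEN iffD1, OF refl _ integrable_push_density[OF f g(3)]])
        (use comp in \<open>auto simp only: space_lebn\<close>)
    \<comment> \<open>The head of the list is the outermost layer. Applying it to both densities
      keeps their distance; replacing the pushed \<open>p\<close> by \<open>p\<close> then costs at
      most \<open>L\<close>.\<close>
    have "L1_norm d (\<lambda>z. ?q z - p z) = L1_norm d (\<lambda>z. push_density d f ?q z - push_density d f p z)"
      by (rule L1_norm_push_density_diff[OF f g(3) p, symmetric])
    also have "\<dots> \<le> L1_norm d (\<lambda>z. push_density d f ?q z - p z) + L1_norm d (\<lambda>z. p z - push_density d f p z)"
      by (rule L1_norm_triangle[OF integrable_push_density[OF f g(3)] p integrable_push_density[OF f p]])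
    also have "L1_norm d (\<lambda>z. p z - push_density d f p z) = L1_norm d (\<lambda>z. push_density d f p z - p z)"
      by (simp only: L1_norm_def abs_minus_commute)
    also have "\<dots> \<le> L" by (rule L[OF f])
    also have "L1_norm d (\<lambda>z. push_density d f ?q z - p z) = L1_norm d (\<lambda>z. push_density d (f \<circ> ?g fs) q z - p z)"
      by (rule L1_norm_cong) (use comp in \<open>simp only:\<close>)
    finally have "L1_norm d (\<lambda>z. q z - p z)
        \<le> L1_norm d (\<lambda>z. push_density d (f \<circ> ?g fs) q z - p z) + (L + real (length fs) * L)"
      using IH by linarith
    then have "L1_norm d (\<lambda>z. q z - p z)
        \<le> L1_norm d (\<lambda>z. push_density d (f \<circ> ?g fs) q z - p z) + real (length (f # fs)) * L"
      by (simp only: list.size of_nat_add of_nat_Suc distrib_right mult_1 add_0 of_nat_0 mult_zero_left add.commute)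
    moreover have "bij_betw (f \<circ> ?g fs) (Rn d) (Rn d)"
      by (rule bij_betw_trans[OF g(1) bij])
    moreover have "partially_diff d (f \<circ> ?g fs)"
      unfolding pl by (rule planar_map_comp(1)[OF h g(2)])
    moreover have "?g (f # fs) = f \<circ> ?g fs" by (simp only: foldr.simps o_apply)
    ultimately show ?case
      using int by (simp only: simp_thms)
  qed
  then show ?thesis by blast
qed

section \<open>Estimates for the radial density\<close>

lemma normn_diff_le: "\<bar>normn d x - normn d y\<bar> \<le> normn d (\<lambda>i. x i - y i)"
proof -
  have "normn d x \<le> normn d (\<lambda>i. x i - y i) + normn d y"
    using L2_set_triangle_ineq[of "\<lambda>i. x i - y i" y "{..<d}"] by simp
  moreover have "normn d y \<le> normn d (\<lambda>i. y i - x i) + normn d x"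
    using L2_set_triangle_ineq[of "\<lambda>i. y i - x i" x "{..<d}"] by simp
  moreover have "normn d (\<lambda>i. y i - x i) = normn d (\<lambda>i. x i - y i)"
    by (simp add: L2_set_def power2_commute)
  ultimately show ?thesis by linarith
qed

lemma normn_scale: "normn d (\<lambda>i. c * x i) = \<bar>c\<bar> * normn d x"
  by (simp add: L2_set_def power_mult_distrib sum_distrib_left[symmetric] real_sqrt_mult)

lemma normn_sq: "(normn d x)\<^sup>2 = (\<Sum>i<d. (x i)\<^sup>2)"
  by (simp add: L2_set_def sum_nonneg)

lemma abs_dotn_le: "\<bar>dotn d x y\<bar> \<le> normn d x * normn d y"
  unfolding dotn_def
  using L2_set_mult_ineq[of x y "{..<d}"] sum_abs[of "\<lambda>i. x i * y i" "{..<d}"]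
  by (simp add: abs_mult)

text \<open>Concavity enters as subadditivity: \<open>u \<le> u powr t\<close> on the unit interval
  is applied to the shares \<open>a / (a + b)\<close> and \<open>b / (a + b)\<close>.\<close>

lemma powr_diff_le:
  fixes x y c t :: real
  assumes "0 \<le> x" "0 \<le> y" "\<bar>x - y\<bar> \<le> c" "0 < t" "t < 1"
  shows "\<bar>x powr t - y powr t\<bar> \<le> c powr t"
proof -
  have sub: "(a + b) powr t \<le> a powr t + b powr t" if "0 \<le> a" "0 \<le> b" for a b :: real
  proof (cases "a + b = 0")
    case False
    then have s: "0 < a + b" using that by linarith
    have le: "u \<le> u powr t" if "0 \<le> u" "u \<le> 1" for u :: real
      using powr_mono'[of t 1 u] that assms by (cases "u = 0") auto
    have "1 = a / (a + b) + b / (a + b)" using s by (simp add: add_divide_distrib[symmetric])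
    also have "\<dots> \<le> (a / (a + b)) powr t + (b / (a + b)) powr t"
      using that s by (intro add_mono le) auto
    also have "\<dots> = (a powr t + b powr t) / (a + b) powr t"
      using that s by (simp add: powr_divide add_divide_distrib)
    finally show ?thesis using s by (simp add: field_simps)
  qed simp
  have le: "a powr t \<le> b powr t + c powr t" if "0 \<le> a" "0 \<le> b" "a - b \<le> c" "0 \<le> c" for a b
  proof -
    have "a powr t \<le> (b + c) powr t" using that assms by (intro powr_mono2) auto
    with sub[of b c] that show ?thesis by linarith
  qed
  show ?thesis
    using le[of x y] le[of y x] assms by (auto simp: abs_le_iff)
qed

text \<open>If \<open>g\<close> is not integrable, its Bochner integral is 0, and division by 0
  makes the normalized function vanish; the bound thus holds whatever the normalizing constant
  is.\<close>

lemma nn_integral_normalized_le: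
  assumes g: "g \<in> borel_measurable (lebn d)" "\<And>z. 0 \<le> g z"
  shows "(\<integral>\<^sup>+z. ennreal (normalized d g z) \<partial>lebn d) \<le> 1"
proof (cases "integrable (lebn d) g \<and> (\<integral>y. g y \<partial>lebn d) \<noteq> 0")
  case True
  then have "(\<integral>\<^sup>+z. ennreal (normalized d g z) \<partial>lebn d) = ennreal (\<integral>z. normalized d g z \<partial>lebn d)"
    unfolding normalized_def using g by (intro nn_integral_eq_integral) auto
  also have "\<dots> = 1" using True by (simp add: normalized_def)
  finally show ?thesis by simp
next
  case False
  then have "(\<integral>y. g y \<partial>lebn d) = 0" using not_integrable_integral_eq by blast
  then show ?thesis by (simp add: normalized_def)
qed

lemma normalized_nonneg: "(\<And>z. 0 \<le> g z) \<Longrightarrow> 0 \<le> normalized d g z"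
  unfolding normalized_def by simp

lemma measurable_normalized [measurable]:
  "g \<in> borel_measurable (lebn d) \<Longrightarrow> normalized d g \<in> borel_measurable (lebn d)"
  unfolding normalized_def[abs_def] by simp

lemma integrable_normalized:
  assumes g: "g \<in> borel_measurable (lebn d)" "\<And>z. 0 \<le> g z"
  shows "integrable (lebn d) (normalized d g)" "(\<integral>z. normalized d g z \<partial>lebn d) \<le> 1"
proof -
  show "integrable (lebn d) (normalized d g)"
    using nn_integral_normalized_le[OF g] normalized_nonneg[of g d] g
    by (intro integrableI_bounded) (auto simp: le_less_trans)
  then have "(\<integral>\<^sup>+z. ennreal (normalized d g z) \<partial>lebn d) = ennreal (\<integral>z. normalized d g z \<partial>lebn d)"
    using normalized_nonneg[of g d] g by (intro nn_integral_eq_integral) auto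
  then show "(\<integral>z. normalized d g z \<partial>lebn d) \<le> 1"
    using nn_integral_normalized_le[OF g] by (simp add: ennreal_le_1)
qed

lemma p1_measurable [measurable]: "p1 \<tau> d \<in> borel_measurable (lebn d)"
  unfolding p1_def by measurable

lemma p1_nonneg: "0 \<le> p1 \<tau> d z"
  unfolding p1_def by (intro normalized_nonneg) simp

lemma integrable_p1: "integrable (lebn d) (p1 \<tau> d)" "(\<integral>z. p1 \<tau> d z \<partial>lebn d) \<le> 1"
  unfolding p1_def by (rule integrable_normalized; simp)+

text \<open>As a maximum, the exponent inherits the modulus of continuity of
  \<open>normn d z powr \<tau>\<close> also across the sphere where the two branches meet;
  \<open>p2_shift\<close> rests on this.\<close>

lemma p2_alt:
  assumes "0 < \<tau>"
  shows "p2 \<tau> d = normalized d (\<lambda>z. exp (- max (real d) (normn d z powr \<tau>)))"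
proof -
  have "normn d z \<le> real d powr (1 / \<tau>) \<longleftrightarrow> normn d z powr \<tau> \<le> real d" for z
  proof -
    have "(real d powr (1 / \<tau>)) powr \<tau> = real d" using assms by (simp add: powr_powr)
    moreover have "normn d z \<le> real d powr (1 / \<tau>)
        \<longleftrightarrow> normn d z powr \<tau> \<le> (real d powr (1 / \<tau>)) powr \<tau>"
      using assms powr_less_mono2[of \<tau> "real d powr (1 / \<tau>)" "normn d z"]
        powr_mono2[of \<tau> "normn d z" "real d powr (1 / \<tau>)"] by fastforce
    ultimately show ?thesis by simp
  qed
  then have "(\<lambda>z. if normn d z \<le> real d powr (1 / \<tau>) then exp (- real d) else exp (- (normn d z powr \<tau>)))
      = (\<lambda>z. exp (- max (real d) (normn d z powr \<tau>)))"
    by (auto simp: fun_eq_iff max_def)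
  then show ?thesis unfolding p2_def by simp
qed

lemma integrable_p2:
  assumes "0 < \<tau>"
  shows "integrable (lebn d) (p2 \<tau> d)" "(\<integral>z. p2 \<tau> d z \<partial>lebn d) \<le> 1"
  unfolding p2_alt[OF assms] by (rule integrable_normalized; simp)+

lemma p2_nonneg: "0 < \<tau> \<Longrightarrow> 0 \<le> p2 \<tau> d z"
  unfolding p2_alt by (intro normalized_nonneg) simp

text \<open>A comparison of Harnack type: the normalizing constant is common to both sides, so only
  the oscillation of the exponent counts.\<close>

lemma normalized_exp_shift:
  assumes "\<bar>\<Phi> x - \<Phi> y\<bar> \<le> c"
  shows "normalized d (\<lambda>z. exp (- \<Phi> z)) x \<le> exp c * normalized d (\<lambda>z. exp (- \<Phi> z)) y"
proof -
  have "exp (- \<Phi> x) \<le> exp (c - \<Phi> y)" using assms by simp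
  also have "\<dots> = exp c * exp (- \<Phi> y)" by (simp add: exp_add[symmetric])
  finally show ?thesis
    unfolding normalized_def times_divide_eq_right by (intro divide_right_mono) auto
qed

lemma p1_shift:
  assumes "0 < \<tau>" "\<tau> < 1" "\<bar>normn d x - normn d y\<bar> \<le> c"
  shows "p1 \<tau> d x \<le> exp (c powr \<tau>) * p1 \<tau> d y"
  unfolding p1_def using assms
  by (intro normalized_exp_shift powr_diff_le) auto

lemma p2_shift:
  assumes "0 < \<tau>" "\<tau> < 1" "\<bar>normn d x - normn d y\<bar> \<le> c"
  shows "p2 \<tau> d x \<le> exp (c powr \<tau>) * p2 \<tau> d y"
proof -
  have "\<bar>normn d x powr \<tau> - normn d y powr \<tau>\<bar> \<le> c powr \<tau>"
    using assms by (intro powr_diff_le) auto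
  then have "\<bar>max (real d) (normn d x powr \<tau>) - max (real d) (normn d y powr \<tau>)\<bar> \<le> c powr \<tau>"
    by linarith
  then show ?thesis
    unfolding p2_alt[OF assms(1)] by (rule normalized_exp_shift)
qed

text \<open>Dilating by the factor \<open>x powr (- 1 / \<tau>)\<close> shows that small balls have tiny mass.\<close>

lemma p1_small_ball:
  assumes \<tau>: "0 < \<tau>" and x: "1 < x" and \<rho>: "0 \<le> \<rho>"
  shows "(\<integral>z. p1 \<tau> d z * indicator {z. normn d z \<le> \<rho>} z \<partial>lebn d)
    \<le> x powr (- real d / \<tau>) * exp ((x - 1) * \<rho> powr \<tau>)"
proof -
  define l where "l = x powr (- 1 / \<tau>)"
  have l: "0 < l" using x by (simp add: l_def)
  have "l powr \<tau> = 1 / x"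
    using x \<tau> powr_powr[of x "- 1 / \<tau>" \<tau>] by (simp add: l_def powr_minus_divide[of x 1] del: powr_powr)
  then have lt: "(l * a) powr \<tau> = a powr \<tau> / x" if "0 \<le> a" for a
    using that l by (simp add: powr_mult)
  have ld: "l ^ d = x powr (- real d / \<tau>)"
    using x by (simp add: l_def powr_realpow[symmetric] powr_powr)
  define F where "F z = p1 \<tau> d z * indicator {z. normn d z \<le> \<rho>} z" for z
  have Fm[measurable]: "F \<in> borel_measurable (lebn d)"
  proof -
    have "(\<lambda>z. if normn d z \<le> \<rho> then p1 \<tau> d z else 0) \<in> borel_measurable (lebn d)" by measurable
    moreover have "(\<lambda>z. if normn d z \<le> \<rho> then p1 \<tau> d z else 0) = F"
      by (auto simp: F_def fun_eq_iff)
    ultimately show ?thesis by simp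
  qed
  have F0: "0 \<le> F z" for z using p1_nonneg by (simp add: F_def)
  define C where "C = exp ((x - 1) * \<rho> powr \<tau>)"
  have pt: "F (\<lambda>i\<in>{..<d}. 0 + l * z (id i)) \<le> C * p1 \<tau> d z" for z
  proof -
    define y where "y = (\<lambda>i\<in>{..<d}. 0 + l * z (id i))"
    have ny: "normn d y = l * normn d z"
      using normn_scale[where c=l and x=z] l by (simp add: y_def cong: L2_set_cong_simp)
    show ?thesis
    proof (cases "normn d y \<le> \<rho>")
      case True
      then have "(l * normn d z) powr \<tau> \<le> \<rho> powr \<tau>"
        using \<tau> l ny by (intro powr_mono2) auto
      then have le: "normn d z powr \<tau> / x \<le> \<rho> powr \<tau>" by (simp add: lt)
      \<comment> \<open>The dilation lowers the exponent by \<open>x - 1\<close> times the exponent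
        at the dilated point, and that point lies in the ball.\<close>
      have "normn d z powr \<tau> = normn d z powr \<tau> / x + (x - 1) * (normn d z powr \<tau> / x)"
        using x by (simp add: field_simps)
      also have "\<dots> \<le> normn d z powr \<tau> / x + (x - 1) * \<rho> powr \<tau>"
        using le x by (intro add_left_mono mult_left_mono) auto
      finally have "exp (- (normn d y powr \<tau>)) \<le> exp ((x - 1) * \<rho> powr \<tau> + - (normn d z powr \<tau>))"
        by (simp add: ny lt)
      then have "exp (- (normn d y powr \<tau>)) \<le> C * exp (- (normn d z powr \<tau>))"
        unfolding C_def exp_add .
      then have "p1 \<tau> d y \<le> C * p1 \<tau> d z"
        unfolding p1_def normalized_def times_divide_eq_right by (intro divide_right_mono) auto
      then have "F y \<le> C * p1 \<tau> d z" using True by (simp add: F_def)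
      then show ?thesis by (simp only: y_def)
    next
      case False
      then have "F y \<le> C * p1 \<tau> d z" using p1_nonneg[of \<tau> d z] by (simp add: F_def C_def)
      then show ?thesis by (simp only: y_def)
    qed
  qed
  have "(\<integral>\<^sup>+z. ennreal (F z) \<partial>lebn d)
      = ennreal (\<Prod>i\<in>{..<d}. \<bar>l\<bar>) * (\<integral>\<^sup>+z. ennreal (F (\<lambda>i\<in>{..<d}. 0 + l * z (id i))) \<partial>lebn d)"
    unfolding lebn_def
    by (rule nn_integral_PiM_affine[OF finite_lessThan bij_betw_id, symmetric])
      (use l Fm in \<open>auto simp: lebn_def\<close>)
  also have "\<dots> \<le> ennreal (l ^ d) * (\<integral>\<^sup>+z. ennreal (C * p1 \<tau> d z) \<partial>lebn d)"
    using l pt by (auto intro!: mult_mono nn_integral_mono ennreal_leI)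
  also have "(\<integral>\<^sup>+z. ennreal (C * p1 \<tau> d z) \<partial>lebn d) = ennreal (C * (\<integral>z. p1 \<tau> d z \<partial>lebn d))"
    using integrable_p1 p1_nonneg by (subst nn_integral_eq_integral) (auto simp: C_def)
  also have "\<dots> \<le> ennreal C"
    using integrable_p1(2)[of d \<tau>] by (intro ennreal_leI) (simp add: C_def)
  finally have "(\<integral>\<^sup>+z. ennreal (F z) \<partial>lebn d) \<le> ennreal (l ^ d) * ennreal C"
    by (simp add: mult_left_mono)
  then have "(\<integral>\<^sup>+z. ennreal (F z) \<partial>lebn d) \<le> ennreal (l ^ d * C)"
    using l by (simp add: ennreal_mult' C_def)
  then have "(\<integral>z. F z \<partial>lebn d) \<le> l ^ d * C"
    using F0 Fm l by (subst integral_eq_nn_integral) (auto intro!: enn2real_leI simp: C_def)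
  then show ?thesis by (simp add: F_def C_def ld)
qed

text \<open>The measure-preserving case of the affine formula, as an equality of measures so that it
  also serves Bochner integrals of functions of varying sign.\<close>

lemma distr_lebn_signed_perm:
  assumes \<pi>: "bij_betw \<pi> {..<d} {..<d}" and a: "\<And>i. i < d \<Longrightarrow> \<bar>a i\<bar> = 1"
  shows "(\<lambda>z. \<lambda>i\<in>{..<d}. v i + a i * z (\<pi> i)) \<in> lebn d \<rightarrow>\<^sub>M lebn d" (is ?M)
    and "distr (lebn d) (lebn d) (\<lambda>z. \<lambda>i\<in>{..<d}. v i + a i * z (\<pi> i)) = lebn d"
proof -
  let ?T = "\<lambda>z. \<lambda>i\<in>{..<d}. v i + a i * z (\<pi> i)"
  have "\<pi> i < d" if "i < d" for i using \<pi> that by (auto simp: bij_betw_def)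
  then show T: ?M
    by (intro measurable_lebn_restrict) measurable
  show "distr (lebn d) (lebn d) ?T = lebn d"
  proof (rule measure_eqI)
    fix A assume "A \<in> sets (distr (lebn d) (lebn d) ?T)"
    then have A[measurable]: "A \<in> sets (lebn d)" by simp
    have a0: "a i \<noteq> 0" if "i \<in> {..<d}" for i using a[of i] that by auto
    have "emeasure (distr (lebn d) (lebn d) ?T) A = (\<integral>\<^sup>+z. indicator A z \<partial>distr (lebn d) (lebn d) ?T)"
      by simp
    also have "\<dots> = (\<integral>\<^sup>+z. indicator A (?T z) \<partial>lebn d)"
      using T by (intro nn_integral_distr) auto
    also have "\<dots> = ennreal (\<Prod>i\<in>{..<d}. \<bar>a i\<bar>) * (\<integral>\<^sup>+z. indicator A (?T z) \<partial>lebn d)"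
      using a by simp
    also have "\<dots> = (\<integral>\<^sup>+z. indicator A z \<partial>lebn d)"
      unfolding lebn_def using a0 A
      by (intro nn_integral_PiM_affine[OF finite_lessThan \<pi>]) (auto simp: lebn_def)
    finally show "emeasure (distr (lebn d) (lebn d) ?T) A = emeasure (lebn d) A" by simp
  qed simp
qed

lemma integral_lebn_signed_perm:
  fixes F :: "(nat \<Rightarrow> real) \<Rightarrow> real" and a v :: "nat \<Rightarrow> real"
  assumes "bij_betw \<pi> {..<d} {..<d}" "\<And>i. i < d \<Longrightarrow> \<bar>a i\<bar> = 1" "F \<in> borel_measurable (lebn d)"
  shows "(\<integral>z. F (\<lambda>i\<in>{..<d}. v i + a i * z (\<pi> i)) \<partial>lebn d) = (\<integral>z. F z \<partial>lebn d)"
  using integral_distr[OF distr_lebn_signed_perm(1)[OF assms(1,2), where v=v] assms(3)]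
    distr_lebn_signed_perm(2)[OF assms(1,2), where v=v] by simp

text \<open>Sign changes annihilate the mixed moments and transpositions equate the pure ones.\<close>

lemma p1_directional_moment:
  assumes d: "0 < d"
  shows "(\<integral>z. p1 \<tau> d z * ((dotn d v z)\<^sup>2 / (normn d z)\<^sup>2) \<partial>lebn d) \<le> (normn d v)\<^sup>2 / real d"
proof -
  define m where "m i j z = p1 \<tau> d z * (z i * z j / (normn d z)\<^sup>2)" for i j and z :: "nat \<Rightarrow> real"
  define I where "I i j = (\<integral>z. m i j z \<partial>lebn d)" for i j
  have mm[measurable]: "m i j \<in> borel_measurable (lebn d)" if "i < d" "j < d" for i j
    unfolding m_def[abs_def] using that by measurable
  have bnd: "\<bar>z i * z j / (normn d z)\<^sup>2\<bar> \<le> 1" if "i < d" "j < d" for i j and z :: "nat \<Rightarrow> real"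
  proof -
    have "\<bar>z k\<bar> \<le> normn d z" if "k < d" for k
      using member_le_L2_set[of "{..<d}" k "\<lambda>i. \<bar>z i\<bar>"] that by (simp add: L2_set_def)
    then have "\<bar>z i * z j\<bar> \<le> normn d z * normn d z"
      unfolding abs_mult using that by (intro mult_mono) auto
    then show ?thesis by (cases "normn d z = 0") (auto simp: power2_eq_square divide_le_eq zero_less_mult_iff)
  qed
  have int: "integrable (lebn d) (m i j)" if "i < d" "j < d" for i j
  proof (rule Bochner_Integration.integrable_bound[OF integrable_p1(1)[of d \<tau>]])
    have "norm (m i j z) \<le> norm (p1 \<tau> d z)" for z
      using mult_left_mono[OF bnd[OF that, of z] p1_nonneg[of \<tau> d z]] p1_nonneg[of \<tau> d z]
      by (simp only: m_def real_norm_def abs_mult[of "p1 \<tau> d z"] abs_of_nonneg mult_1_right)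
    then show "AE z in lebn d. norm (m i j z) \<le> norm (p1 \<tau> d z)" by simp
  qed (use that in measurable)
  have p1_cong: "p1 \<tau> d x = p1 \<tau> d y" if "normn d x = normn d y" for x y
    using that by (simp add: p1_def normalized_def)
  have off: "I i j = 0" if "i < d" "j < d" "i \<noteq> j" for i j
  proof -
    define T where "T z = (\<lambda>k\<in>{..<d}. 0 + (if k = i then - 1 else 1) * z (id k))" for z :: "nat \<Rightarrow> real"
    have "normn d (T z) = normn d z" for z
      unfolding L2_set_def by (intro arg_cong[where f=sqrt] sum.cong) (auto simp: T_def)
    then have "m i j (T z) = - m i j z" for z
      using that p1_cong[of "T z" z] by (simp add: m_def) (simp add: T_def)
    moreover have "(\<integral>z. m i j (T z) \<partial>lebn d) = I i j"
      unfolding T_def I_def by (rule integral_lebn_signed_perm[OF bij_betw_id]) (use that in auto)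
    ultimately show ?thesis by (simp add: I_def)
  qed
  have diag: "I i i = I 0 0" if "i < d" for i
  proof -
    define T where "T z = (\<lambda>k\<in>{..<d}. 0 + 1 * z (Transposition.transpose 0 i k))" for z :: "nat \<Rightarrow> real"
    have bij: "bij_betw (Transposition.transpose 0 i) {..<d} {..<d}"
      using that d by (intro bij_betw_byWitness[where f'="Transposition.transpose 0 i"])
        (auto simp: Transposition.transpose_def)
    have "normn d (T z) = normn d z" for z
      unfolding L2_set_def T_def
      using sum.reindex_bij_betw[OF bij, of "\<lambda>k. (z k)\<^sup>2"] by simp
    then have "m 0 0 (T z) = m i i z" for z
      using that d p1_cong[of "T z" z] by (simp add: m_def) (simp add: T_def)
    moreover have "(\<integral>z. m 0 0 (T z) \<partial>lebn d) = I 0 0"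
      unfolding T_def I_def by (rule integral_lebn_signed_perm[OF bij]) (use d in auto)
    ultimately show ?thesis by (simp add: I_def)
  qed
  \<comment> \<open>The trace of the moment matrix is the density itself, except at norm 0, where
    \<open>0 / 0 = 0\<close> leaves only an inequality. Sharing this trace equally among
    \<open>d\<close> directions produces the factor \<open>1 / d\<close>.\<close>
  have "(\<Sum>i<d. m i i z) \<le> p1 \<tau> d z" for z
  proof -
    have "(\<Sum>i<d. m i i z) = p1 \<tau> d z * ((normn d z)\<^sup>2 / (normn d z)\<^sup>2)"
      unfolding m_def normn_sq by (simp add: sum_distrib_left[symmetric] sum_divide_distrib[symmetric] power2_eq_square)
    then show ?thesis using p1_nonneg[of \<tau> d z] by simp
  qed
  then have "(\<integral>z. (\<Sum>i<d. m i i z) \<partial>lebn d) \<le> (\<integral>z. p1 \<tau> d z \<partial>lebn d)"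
    using int integrable_p1 by (intro integral_mono) auto
  also have "(\<integral>z. (\<Sum>i<d. m i i z) \<partial>lebn d) = (\<Sum>i<d. I i i)"
    unfolding I_def using int by (intro Bochner_Integration.integral_sum) auto
  also have "\<dots> = (\<Sum>i<d. I 0 0)" by (intro sum.cong) (auto intro: diag)
  also have "\<dots> = real d * I 0 0" by simp
  finally have I0: "I 0 0 \<le> 1 / real d"
    using integrable_p1(2)[of d \<tau>] d by (simp add: field_simps)
  have "p1 \<tau> d z * ((dotn d v z)\<^sup>2 / (normn d z)\<^sup>2) = (\<Sum>i<d. \<Sum>j<d. v i * v j * m i j z)" for z
  proof -
    have "(dotn d v z)\<^sup>2 = (\<Sum>i<d. \<Sum>j<d. (v i * z i) * (v j * z j))"
      unfolding dotn_def power2_eq_square by (rule sum_product)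
    then show ?thesis
      unfolding m_def by (simp only: sum_divide_distrib sum_distrib_left)
        (intro sum.cong refl, simp add: mult_ac)
  qed
  then have "(\<integral>z. p1 \<tau> d z * ((dotn d v z)\<^sup>2 / (normn d z)\<^sup>2) \<partial>lebn d)
      = (\<integral>z. (\<Sum>i<d. \<Sum>j<d. v i * v j * m i j z) \<partial>lebn d)"
    by simp
  also have "\<dots> = (\<Sum>i<d. \<integral>z. (\<Sum>j<d. v i * v j * m i j z) \<partial>lebn d)"
    using int by (intro Bochner_Integration.integral_sum) auto
  also have "\<dots> = (\<Sum>i<d. \<Sum>j<d. v i * v j * I i j)"
  proof (rule sum.cong[OF refl])
    fix i assume "i \<in> {..<d}"
    then have "(\<integral>z. (\<Sum>j<d. v i * v j * m i j z) \<partial>lebn d) = (\<Sum>j<d. \<integral>z. v i * v j * m i j z \<partial>lebn d)"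
      using int by (intro Bochner_Integration.integral_sum) auto
    then show "(\<integral>z. (\<Sum>j<d. v i * v j * m i j z) \<partial>lebn d) = (\<Sum>j<d. v i * v j * I i j)"
      by (simp add: I_def)
  qed
  also have "\<dots> = (\<Sum>i<d. \<Sum>j<d. if i = j then (v i)\<^sup>2 * I 0 0 else 0)"
  proof (intro sum.cong refl)
    fix i j assume "i \<in> {..<d}" "j \<in> {..<d}"
    then show "v i * v j * I i j = (if i = j then (v i)\<^sup>2 * I 0 0 else 0)"
      by (cases "i = j") (simp_all add: off diag[of j] power2_eq_square)
  qed
  also have "\<dots> = (normn d v)\<^sup>2 * I 0 0"
    by (simp add: normn_sq sum_distrib_right)
  also have "\<dots> \<le> (normn d v)\<^sup>2 * (1 / real d)"
    by (intro mult_left_mono I0) simp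
  finally show ?thesis by simp
qed

section \<open>Translations of the radial density and averages of local weights\<close>

lemma p1_cong: "(\<And>i. i < d \<Longrightarrow> x i = y i) \<Longrightarrow> p1 \<tau> d x = p1 \<tau> d y"
  unfolding p1_def normalized_def by (simp cong: L2_set_cong_simp)

text \<open>The slope \<open>t * x powr (t - 1)\<close> is largest at the left end, and its factor
  \<open>t\<close> is given away. Concretely the bound comes from
  \<open>(u / v) powr t \<le> u / v\<close> for \<open>v \<le> u\<close>.\<close>

lemma powr_lipschitz:
  fixes x y a t :: real
  assumes "0 < a" "a \<le> x" "a \<le> y" "0 < t" "t < 1"
  shows "\<bar>x powr t - y powr t\<bar> \<le> a powr (t - 1) * \<bar>x - y\<bar>"
proof -
  have le: "u powr t - v powr t \<le> a powr (t - 1) * (u - v)" if "a \<le> v" "v \<le> u" for u v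
  proof -
    have v: "0 < v" "0 < u" using that assms by auto
    have "u powr t = v powr t * (u / v) powr t"
      using v by (simp add: powr_divide)
    also have "(u / v) powr t \<le> u / v"
      using powr_mono[of t 1 "u / v"] v that assms by simp
    finally have "u powr t - v powr t \<le> v powr t * (u / v) - v powr t"
      by (simp add: mult_left_mono)
    also have "\<dots> = v powr (t - 1) * (u - v)"
      using v by (simp add: powr_diff field_simps)
    also have "\<dots> \<le> a powr (t - 1) * (u - v)"
      using that assms by (intro mult_right_mono powr_mono2') auto
    finally show ?thesis .
  qed
  have mono: "u powr t \<le> v powr t" if "a \<le> u" "u \<le> v" for u v
    using that assms by (intro powr_mono2) auto
  show ?thesis
  proof (cases "x \<le> y")
    case True
    then show ?thesis using le[of x y] mono[of x y] assms by simp
  next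
    case False
    then show ?thesis using le[of y x] mono[of y x] assms by simp
  qed
qed

lemma abs_exp_diff_le:
  fixes a b :: real
  assumes "\<bar>a - b\<bar> \<le> 1"
  shows "\<bar>exp (- a) - exp (- b)\<bar> \<le> exp 1 * exp (- b) * \<bar>a - b\<bar>"
proof -
  define t where "t = b - a"
  have t: "\<bar>exp t - 1\<bar> \<le> exp 1 * \<bar>t\<bar>"
  proof (cases "0 \<le> t")
    case True
    have "exp t - 1 = exp t * (1 - exp (- t))" by (simp add: algebra_simps exp_add[symmetric])
    also have "\<dots> \<le> exp t * t" using exp_ge_add_one_self[of "- t"] by (intro mult_left_mono) auto
    also have "\<dots> \<le> exp 1 * t" using True assms by (intro mult_right_mono) (auto simp: t_def)
    finally show ?thesis using True by simp
  next
    case False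
    then have "exp t \<le> 1" by simp
    then have "\<bar>exp t - 1\<bar> \<le> \<bar>t\<bar>" using exp_ge_add_one_self[of t] by linarith
    also have "\<dots> \<le> exp 1 * \<bar>t\<bar>" using mult_right_mono[of 1 "exp 1" "\<bar>t\<bar>"] by simp
    finally show ?thesis .
  qed
  have "exp (- a) - exp (- b) = exp (- b) * (exp t - 1)"
    by (simp add: t_def algebra_simps exp_add[symmetric])
  then have "\<bar>exp (- a) - exp (- b)\<bar> = exp (- b) * \<bar>exp t - 1\<bar>" by (simp add: abs_mult)
  also have "\<dots> \<le> exp (- b) * (exp 1 * \<bar>t\<bar>)" by (intro mult_left_mono t) simp
  finally show ?thesis by (simp add: t_def abs_minus_commute mult_ac)
qed

text \<open>Beyond radius \<open>R + 1\<close> both \<open>z\<close> and its translate have norm at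
  least \<open>R\<close>, where the exponent has Lipschitz constant
  \<open>d powr (1 - 1 / \<tau>)\<close> in the radius. A unit translation changes the radius by
  about \<open>dotn d v z / normn d z\<close>, whose mean square is at most \<open>1 / d\<close>;
  this is the origin of the additional \<open>d powr (- 1 / 2)\<close>. Inside that radius the two
  densities are comparable, and the small mass of the ball suffices.\<close>

lemma p1_translation_L1:
  assumes \<tau>: "0 < \<tau>" "\<tau> < 1" and d: "0 < d" and v: "normn d v = 1"
  defines "R \<equiv> real d powr (1 / \<tau>)"
  shows "(\<integral>z. \<bar>p1 \<tau> d (\<lambda>i\<in>{..<d}. - v i + z i) - p1 \<tau> d z\<bar> \<partial>lebn d)
    \<le> (exp 1 + 1) * (\<integral>z. p1 \<tau> d z * indicator {z. normn d z \<le> R + 1} z \<partial>lebn d)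
      + 3 * exp 1 * real d powr (1 / 2 - 1 / \<tau>)"
proof -
  define s where "s = sqrt (real d)"
  have s: "0 < s" using d by (simp add: s_def)
  have sR: "s \<le> R"
  proof -
    have "s = real d powr (1 / 2)" using d by (simp add: s_def powr_half_sqrt)
    also have "\<dots> \<le> R" unfolding R_def using d \<tau> by (intro powr_mono) (auto simp: field_simps)
    finally show ?thesis .
  qed
  have R: "0 < R" using s sR by simp
  define S where "S z = (\<lambda>i\<in>{..<d}. - v i + z i)" for z
  define A where "A z = p1 \<tau> d z * indicator {z. normn d z \<le> R + 1} z" for z
  define B where "B z = p1 \<tau> d z * ((dotn d v z)\<^sup>2 / (normn d z)\<^sup>2)" for z
  define k where "k = exp 1 * R powr (\<tau> - 1)"
  have k: "0 \<le> k" by (simp add: k_def)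
  have A0: "0 \<le> A z" and B0: "0 \<le> B z" for z using p1_nonneg by (auto simp: A_def B_def)
  have pt: "\<bar>p1 \<tau> d (S z) - p1 \<tau> d z\<bar> \<le> (exp 1 + 1) * A z + k * (s * B z + 2 / s * p1 \<tau> d z)" for z
  proof -
    define r r' where "r = normn d z" and "r' = normn d (S z)"
    have "normn d (\<lambda>i. S z i - z i) = normn d (\<lambda>i. (-1) * v i)"
      by (rule L2_set_cong) (auto simp: S_def)
    then have rr: "\<bar>r' - r\<bar> \<le> 1"
      using normn_diff_le[where x="S z" and y=z and d=d] v unfolding normn_scale by (simp add: r_def r'_def)
    have rest: "0 \<le> k * (s * B z + 2 / s * p1 \<tau> d z)"
      using k s B0[of z] p1_nonneg[of \<tau> d z] by simp
    show ?thesis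
    proof (cases "r \<le> R + 1")
      case True
      have "p1 \<tau> d (S z) \<le> exp (1 powr \<tau>) * p1 \<tau> d z"
        using rr by (intro p1_shift \<tau>) (simp add: r_def r'_def)
      then have "\<bar>p1 \<tau> d (S z) - p1 \<tau> d z\<bar> \<le> (exp 1 + 1) * p1 \<tau> d z"
        using p1_nonneg[of \<tau> d z] p1_nonneg[of \<tau> d "S z"] by (simp add: algebra_simps abs_le_iff)
      with True rest show ?thesis by (simp add: A_def r_def)
    next
      case False
      then have r: "R \<le> r" "R \<le> r'" "0 < r" "0 < r'" using rr R by auto
      have lip: "\<bar>r' powr \<tau> - r powr \<tau>\<bar> \<le> R powr (\<tau> - 1) * \<bar>r' - r\<bar>"
        using r R \<tau> by (intro powr_lipschitz) auto
      have "\<bar>r' powr \<tau> - r powr \<tau>\<bar> \<le> 1"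
        using powr_diff_le[of r' r 1 \<tau>] rr r \<tau> by simp
      then have "\<bar>exp (- (r' powr \<tau>)) - exp (- (r powr \<tau>))\<bar>
          \<le> exp 1 * exp (- (r powr \<tau>)) * \<bar>r' powr \<tau> - r powr \<tau>\<bar>"
        by (rule abs_exp_diff_le)
      also have "\<dots> \<le> exp 1 * exp (- (r powr \<tau>)) * (R powr (\<tau> - 1) * \<bar>r' - r\<bar>)"
        by (intro mult_left_mono lip) auto
      finally have "\<bar>exp (- (r' powr \<tau>)) - exp (- (r powr \<tau>))\<bar> \<le> k * \<bar>r' - r\<bar> * exp (- (r powr \<tau>))"
        by (simp add: k_def mult_ac)
      then have p: "\<bar>p1 \<tau> d (S z) - p1 \<tau> d z\<bar> \<le> k * \<bar>r' - r\<bar> * p1 \<tau> d z"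
        unfolding p1_def normalized_def diff_divide_distrib[symmetric] times_divide_eq_right abs_divide
        by (simp add: r_def r'_def divide_right_mono)
      define X where "X = \<bar>dotn d v z\<bar> / r"
      have "r'\<^sup>2 = r\<^sup>2 - 2 * dotn d v z + 1"
      proof -
        have "r'\<^sup>2 = (\<Sum>i<d. (z i)\<^sup>2 - 2 * (v i * z i) + (v i)\<^sup>2)"
          unfolding r'_def normn_sq by (intro sum.cong) (auto simp: S_def power2_eq_square algebra_simps)
        also have "\<dots> = r\<^sup>2 - 2 * dotn d v z + (normn d v)\<^sup>2"
          unfolding r_def normn_sq dotn_def by (simp add: sum.distrib sum_subtractf sum_distrib_left)
        finally show ?thesis using v by simp
      qed
      then have "(r' - r) * (r' + r) = 1 - 2 * dotn d v z"
        by (simp add: power2_eq_square algebra_simps)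
      then have "\<bar>r' - r\<bar> * (r' + r) = \<bar>1 - 2 * dotn d v z\<bar>"
        using r by (metis abs_mult abs_of_pos add_pos_pos)
      then have "\<bar>r' - r\<bar> * r \<le> 1 + 2 * \<bar>dotn d v z\<bar>"
        using r mult_left_mono[of r "r' + r" "\<bar>r' - r\<bar>"] by simp
      then have "\<bar>r' - r\<bar> \<le> 1 / r + 2 * X"
        using r by (simp add: X_def field_simps)
      also have "1 / r \<le> 1 / s" using r sR s by (simp add: frac_le)
      \<comment> \<open>The second moment of \<open>X\<close> is controlled, not the first.
        Completing the square with weight \<open>s = sqrt d\<close> makes both terms of order
        \<open>1 / s\<close> after integration.\<close>
      also have "2 * X \<le> s * X\<^sup>2 + 1 / s"
      proof -
        have "0 \<le> (s * X - 1)\<^sup>2 / s" using s by simp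
        also have "\<dots> = s * X\<^sup>2 - 2 * X + 1 / s"
          using s by (simp add: power2_eq_square field_simps)
        finally show ?thesis by simp
      qed
      finally have "\<bar>r' - r\<bar> \<le> s * X\<^sup>2 + 2 / s" by simp
      then have "k * \<bar>r' - r\<bar> * p1 \<tau> d z \<le> k * (s * X\<^sup>2 + 2 / s) * p1 \<tau> d z"
        using k p1_nonneg[of \<tau> d z] by (intro mult_right_mono mult_left_mono) auto
      also have "\<dots> = k * (s * B z + 2 / s * p1 \<tau> d z)"
        by (simp add: B_def X_def r_def power_divide algebra_simps)
      also have "\<dots> \<le> (exp 1 + 1) * A z + k * (s * B z + 2 / s * p1 \<tau> d z)"
        using A0[of z] by (simp add: add_nonneg_nonneg)
      finally show ?thesis using p by linarith
    qed
  qed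
  have Sm[measurable]: "S \<in> lebn d \<rightarrow>\<^sub>M lebn d"
    unfolding S_def[abs_def] by (intro measurable_lebn_restrict) measurable
  have intA: "integrable (lebn d) A"
  proof (rule Bochner_Integration.integrable_bound[OF integrable_p1(1)[of d \<tau>]])
    have "A = (\<lambda>z. if normn d z \<le> R + 1 then p1 \<tau> d z else 0)" by (auto simp: A_def fun_eq_iff)
    then show "A \<in> borel_measurable (lebn d)" by simp
    show "AE z in lebn d. norm (A z) \<le> norm (p1 \<tau> d z)"
      using p1_nonneg by (auto simp: A_def indicator_def)
  qed
  have intB: "integrable (lebn d) B"
  proof (rule Bochner_Integration.integrable_bound[OF integrable_p1(1)[of d \<tau>]])
    show "B \<in> borel_measurable (lebn d)" unfolding B_def[abs_def] by measurable
    have "norm (B z) \<le> norm (p1 \<tau> d z)" for z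
    proof -
      have "\<bar>dotn d v z\<bar> \<le> normn d z" using abs_dotn_le[where x=v and y=z and d=d] v by simp
      then have "(dotn d v z)\<^sup>2 \<le> (normn d z)\<^sup>2" by (metis abs_ge_zero power2_abs power_mono)
      then have "(dotn d v z)\<^sup>2 / (normn d z)\<^sup>2 \<le> 1"
        by (cases "normn d z = 0") (auto simp: divide_le_eq)
      then have "B z \<le> p1 \<tau> d z"
        unfolding B_def using p1_nonneg[of \<tau> d z] by (rule mult_left_le)
      then show ?thesis
        using p1_nonneg[of \<tau> d z] B0[of z] by simp
    qed
    then show "AE z in lebn d. norm (B z) \<le> norm (p1 \<tau> d z)" by simp
  qed
  have "(\<integral>z. \<bar>p1 \<tau> d (S z) - p1 \<tau> d z\<bar> \<partial>lebn d)
      \<le> (\<integral>z. (exp 1 + 1) * A z + k * (s * B z + 2 / s * p1 \<tau> d z) \<partial>lebn d)"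
  proof (rule integral_mono[OF _ _ pt])
    show int: "integrable (lebn d) (\<lambda>z. (exp 1 + 1) * A z + k * (s * B z + 2 / s * p1 \<tau> d z))"
      using intA intB integrable_p1 by auto
    show "integrable (lebn d) (\<lambda>z. \<bar>p1 \<tau> d (S z) - p1 \<tau> d z\<bar>)"
    proof (rule Bochner_Integration.integrable_bound[OF int])
      show "AE z in lebn d. norm \<bar>p1 \<tau> d (S z) - p1 \<tau> d z\<bar> \<le>
          norm ((exp 1 + 1) * A z + k * (s * B z + 2 / s * p1 \<tau> d z))"
        unfolding real_norm_def abs_idempotent by (intro AE_I2 order_trans[OF pt abs_ge_self])
    qed measurable
  qed
  also have "\<dots> = (exp 1 + 1) * (\<integral>z. A z \<partial>lebn d)
      + k * (s * (\<integral>z. B z \<partial>lebn d) + 2 / s * (\<integral>z. p1 \<tau> d z \<partial>lebn d))"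
    using intA intB integrable_p1(1)[of d \<tau>] by simp
  also have "\<dots> \<le> (exp 1 + 1) * (\<integral>z. A z \<partial>lebn d) + k * (s * (1 / real d) + 2 / s * 1)"
    using p1_directional_moment[OF d, of \<tau> v] v integrable_p1(2)[of d \<tau>] k s
    by (intro add_left_mono mult_left_mono add_mono) (auto simp: B_def)
  \<comment> \<open>The 3 collects one \<open>1 / s\<close> from the second moment, one from
    \<open>1 / r\<close> and one from the completed square.\<close>
  also have "k * (s * (1 / real d) + 2 / s * 1) = 3 * exp 1 * real d powr (1 / 2 - 1 / \<tau>)"
  proof -
    have "s * (1 / real d) = 1 / s" using d by (simp add: s_def real_div_sqrt field_simps)
    then have "k * (s * (1 / real d) + 2 / s * 1) = 3 * exp 1 * (R powr (\<tau> - 1) * (1 / s))"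
      by (simp add: k_def distrib_left)
    moreover have "R powr (\<tau> - 1) = real d powr (1 - 1 / \<tau>)"
      using \<tau> by (simp add: R_def powr_powr diff_divide_distrib)
    moreover have "1 / s = real d powr (- 1 / 2)"
      using d by (simp add: s_def powr_half_sqrt[symmetric] powr_minus_divide)
    moreover have "real d powr (1 - 1 / \<tau>) * real d powr (- 1 / 2) = real d powr (1 / 2 - 1 / \<tau>)"
      by (simp add: powr_add[symmetric])
    ultimately show ?thesis by (simp only:)
  qed
  finally show ?thesis by (simp only: S_def A_def)
qed

text \<open>Up to \<open>D\<close> the increment of the logarithm over a step \<open>a\<close> is at
  least \<open>a / (1 + x + a)\<close>, which is at least half of the weight; beyond
  \<open>D\<close> the weight is below \<open>1 / (1 + D)\<close>. The clamp keeps the function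
  below \<open>ln (2 + D)\<close>, and it sits at \<open>D + 1\<close> so that a step of length at
  most 1 from \<open>x \<le> D\<close> does not cross it.\<close>

lemma ln_clamp_increment:
  fixes x a D :: real
  assumes a: "0 \<le> a" "a \<le> 1" and D: "0 \<le> D"
  defines "\<Phi> \<equiv> \<lambda>x. ln (1 + min (max x 0) (D + 1))"
  shows "(if 0 \<le> x then a / (1 + x) else 0) \<le> 2 * (\<Phi> (x + a) - \<Phi> x) + 1 / (1 + D)"
proof -
  have mono: "\<Phi> x \<le> \<Phi> (x + a)" unfolding \<Phi>_def using a D by (subst ln_le_cancel_iff) auto
  consider "x < 0" | "0 \<le> x" "x \<le> D" | "D < x" by linarith
  then show ?thesis
  proof cases
    case 1 then show ?thesis using mono D by simp
  next
    case 2
    have "a / (2 * (1 + x)) \<le> a / (1 + (x + a))"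
      using 2 a by (intro divide_left_mono) auto
    also have "\<dots> = 1 - (1 + x) / (1 + (x + a))" using 2 a by (simp add: field_simps)
    also have "\<dots> \<le> - ln ((1 + x) / (1 + (x + a)))"
      using ln_le_minus_one[of "(1 + x) / (1 + (x + a))"] 2 a by simp
    also have "\<dots> = \<Phi> (x + a) - \<Phi> x" using 2 a by (simp add: \<Phi>_def ln_div)
    finally have "a / (1 + x) \<le> 2 * (\<Phi> (x + a) - \<Phi> x)" using 2 by (simp add: field_simps)
    moreover have "0 \<le> 1 / (1 + D)" using D by simp
    ultimately have "a / (1 + x) \<le> 2 * (\<Phi> (x + a) - \<Phi> x) + 1 / (1 + D)" by linarith
    then show ?thesis using 2 by simp
  next
    case 3
    then have "a / (1 + x) \<le> 1 / (1 + D)" using a D by (intro frac_le) auto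
    then show ?thesis using mono 3 D by simp
  qed
qed

text \<open>Integrate the increment of the clamped logarithm along the unit vector \<open>w / \<parallel>w\<parallel>\<close>
  and move the translation onto the density.\<close>

lemma p1_half_local:
  assumes K: "\<And>v. normn d v = 1 \<Longrightarrow>
      (\<integral>z. \<bar>p1 \<tau> d (\<lambda>i\<in>{..<d}. - v i + z i) - p1 \<tau> d z\<bar> \<partial>lebn d) \<le> K"
    and w: "0 < normn d w" "normn d w \<le> 1" and D: "0 \<le> D"
  shows "(\<integral>z. p1 \<tau> d z * (if 0 \<le> dotn d w z + b then normn d w / (1 + (dotn d w z + b)) else 0) \<partial>lebn d)
    \<le> 2 * ln (2 + D) * K + 1 / (1 + D)"
proof -
  define a where "a = normn d w"
  have a: "0 < a" "a \<le> 1" using w by (auto simp: a_def)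
  define v where "v = (\<lambda>i. 1 / a * w i)"
  have v: "normn d v = 1"
    using a unfolding v_def normn_scale by (simp add: a_def)
  define S where "S z = (\<lambda>i\<in>{..<d}. - v i + z i)" for z
  define T where "T z = (\<lambda>i\<in>{..<d}. v i + 1 * z (id i))" for z
  define \<Phi> where "\<Phi> x = ln (1 + min (max x 0) (D + 1))" for x :: real
  have [measurable]: "\<Phi> \<in> borel_measurable borel" unfolding \<Phi>_def[abs_def] by measurable
  have \<Phi>: "0 \<le> \<Phi> x" "\<Phi> x \<le> ln (2 + D)" for x
    unfolding \<Phi>_def using D by (auto simp: ln_ge_zero_iff)
  define x where "x z = dotn d w z + b" for z
  have [measurable]: "x \<in> borel_measurable (lebn d)" unfolding x_def[abs_def] by measurable
  have Sm[measurable]: "S \<in> lebn d \<rightarrow>\<^sub>M lebn d"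
    unfolding S_def[abs_def] by (intro measurable_lebn_restrict) measurable
  have bounded_int: "integrable (lebn d) (\<lambda>z. g z * p z)"
    if g: "\<And>z. \<bar>g z\<bar> \<le> M" "g \<in> borel_measurable (lebn d)" and p: "integrable (lebn d) p" for g p :: "_ \<Rightarrow> real" and M
  proof (rule Bochner_Integration.integrable_bound)
    show "integrable (lebn d) (\<lambda>z. M * p z)" using p by simp
    have "0 \<le> M" using g(1)[of undefined] by linarith
    then show "AE z in lebn d. norm (g z * p z) \<le> norm (M * p z)"
      using g(1) by (auto simp: abs_mult intro!: mult_right_mono)
  qed (use g p in auto)
  have dw: "dotn d w v = a"
  proof -
    have "dotn d w v = (\<Sum>i<d. (w i)\<^sup>2) / a"
      by (simp add: dotn_def v_def power2_eq_square sum_divide_distrib)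
    also have "\<dots> = a"
      using a unfolding normn_sq[symmetric] by (simp add: a_def power2_eq_square)
    finally show ?thesis .
  qed
  \<comment> \<open>A unit step in space is a step of length \<open>normn d w\<close> in the
    argument, which is exactly the numerator of the weight.\<close>
  have xT: "x (T z) = x z + a" for z
    using dw by (simp add: x_def T_def dotn_def distrib_left sum.distrib)
  have ST: "p1 \<tau> d (S (T z)) = p1 \<tau> d z" for z
    by (rule p1_cong) (simp add: S_def T_def)
  have tr: "(\<integral>z. F (T z) \<partial>lebn d) = (\<integral>z. F z \<partial>lebn d)" if "F \<in> borel_measurable (lebn d)" for F :: "_ \<Rightarrow> real"
    unfolding T_def by (rule integral_lebn_signed_perm[OF bij_betw_id]) (use that in auto)
  have intS: "integrable (lebn d) (\<lambda>z. p1 \<tau> d (S z))"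
  proof -
    have Seq: "S = (\<lambda>z. \<lambda>i\<in>{..<d}. (- v i) + 1 * z (id i))" by (simp add: S_def fun_eq_iff)
    have "integrable (distr (lebn d) (lebn d) S) (p1 \<tau> d)"
      unfolding Seq by (subst distr_lebn_signed_perm(2)[OF bij_betw_id]) (simp_all add: integrable_p1)
    then show ?thesis by (rule integrable_distr[OF Sm])
  qed
  note int = integrable_p1(1)[of d \<tau>]
  have \<Phi>x: "\<bar>\<Phi> (x z)\<bar> \<le> ln (2 + D)" "\<bar>\<Phi> (x z + a)\<bar> \<le> ln (2 + D)" for z
    using \<Phi> by (simp_all add: abs_of_nonneg)
  have i1: "integrable (lebn d) (\<lambda>z. \<Phi> (x z + a) * p1 \<tau> d z)"
    by (rule bounded_int[OF \<Phi>x(2) _ int]) measurable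
  have i0: "integrable (lebn d) (\<lambda>z. \<Phi> (x z) * p1 \<tau> d z)"
    by (rule bounded_int[OF \<Phi>x(1) _ int]) measurable
  have iS: "integrable (lebn d) (\<lambda>z. \<Phi> (x z) * p1 \<tau> d (S z))"
    by (rule bounded_int[OF \<Phi>x(1) _ intS]) measurable
  have "(\<integral>z. \<Phi> (x z + a) * p1 \<tau> d z \<partial>lebn d) = (\<integral>z. \<Phi> (x z) * p1 \<tau> d (S z) \<partial>lebn d)"
    using tr[of "\<lambda>z. \<Phi> (x z) * p1 \<tau> d (S z)"] by (simp add: xT ST)
  then have "(\<integral>z. \<Phi> (x z + a) * p1 \<tau> d z \<partial>lebn d) - (\<integral>z. \<Phi> (x z) * p1 \<tau> d z \<partial>lebn d)
      = (\<integral>z. \<Phi> (x z) * p1 \<tau> d (S z) - \<Phi> (x z) * p1 \<tau> d z \<partial>lebn d)"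
    using iS i0 by simp
  also have "\<dots> \<le> (\<integral>z. ln (2 + D) * \<bar>p1 \<tau> d (S z) - p1 \<tau> d z\<bar> \<partial>lebn d)"
  proof (rule integral_mono)
    fix z
    have "\<Phi> (x z) * (p1 \<tau> d (S z) - p1 \<tau> d z) \<le> \<Phi> (x z) * \<bar>p1 \<tau> d (S z) - p1 \<tau> d z\<bar>"
      using \<Phi> by (intro mult_left_mono) auto
    also have "\<dots> \<le> ln (2 + D) * \<bar>p1 \<tau> d (S z) - p1 \<tau> d z\<bar>"
      using \<Phi> by (intro mult_right_mono) auto
    finally show "\<Phi> (x z) * p1 \<tau> d (S z) - \<Phi> (x z) * p1 \<tau> d z \<le> ln (2 + D) * \<bar>p1 \<tau> d (S z) - p1 \<tau> d z\<bar>"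
      by (simp add: right_diff_distrib)
  qed (use iS i0 intS int in auto)
  also have "\<dots> \<le> ln (2 + D) * K"
    using K[OF v] D by (simp add: S_def mult_left_mono)
  finally have diff: "(\<integral>z. \<Phi> (x z + a) * p1 \<tau> d z \<partial>lebn d) - (\<integral>z. \<Phi> (x z) * p1 \<tau> d z \<partial>lebn d)
      \<le> ln (2 + D) * K" .
  have "(\<integral>z. p1 \<tau> d z * (if 0 \<le> x z then a / (1 + x z) else 0) \<partial>lebn d)
      \<le> (\<integral>z. 2 * (\<Phi> (x z + a) * p1 \<tau> d z - \<Phi> (x z) * p1 \<tau> d z) + 1 / (1 + D) * p1 \<tau> d z \<partial>lebn d)"
  proof (rule integral_mono)
    fix z
    have "p1 \<tau> d z * (if 0 \<le> x z then a / (1 + x z) else 0)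
        \<le> p1 \<tau> d z * (2 * (\<Phi> (x z + a) - \<Phi> (x z)) + 1 / (1 + D))"
      using ln_clamp_increment[of a D "x z"] a D p1_nonneg[of \<tau> d z]
      by (intro mult_left_mono) (simp_all add: \<Phi>_def)
    then show "p1 \<tau> d z * (if 0 \<le> x z then a / (1 + x z) else 0)
        \<le> 2 * (\<Phi> (x z + a) * p1 \<tau> d z - \<Phi> (x z) * p1 \<tau> d z) + 1 / (1 + D) * p1 \<tau> d z"
      by (simp add: algebra_simps)
  next
    have "\<bar>if 0 \<le> x z then a / (1 + x z) else 0\<bar> \<le> 1" for z using a by (auto simp: divide_le_eq)
    then have "integrable (lebn d) (\<lambda>z. (if 0 \<le> x z then a / (1 + x z) else 0) * p1 \<tau> d z)"
      by (rule bounded_int[OF _ _ int]) measurable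
    then show "integrable (lebn d) (\<lambda>z. p1 \<tau> d z * (if 0 \<le> x z then a / (1 + x z) else 0))"
      by (simp only: mult.commute)
  qed (use i0 i1 int in auto)
  also have "\<dots> = 2 * ((\<integral>z. \<Phi> (x z + a) * p1 \<tau> d z \<partial>lebn d) - (\<integral>z. \<Phi> (x z) * p1 \<tau> d z \<partial>lebn d))
      + 1 / (1 + D) * (\<integral>z. p1 \<tau> d z \<partial>lebn d)"
    using i0 i1 int by simp
  also have "\<dots> \<le> 2 * (ln (2 + D) * K) + 1 / (1 + D) * 1"
    using diff integrable_p1(2)[of d \<tau>] D by (intro add_mono mult_left_mono) auto
  finally show ?thesis by (simp only: a_def x_def mult.assoc)
qed

text \<open>The two half-spaces bounded by the hyperplane are covered by the one-sided bound for
  \<open>(w, b)\<close> and for \<open>(- w, - b)\<close>, hence the doubled constants. A zero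
  \<open>w\<close> has no unit direction, but makes the weight vanish.\<close>

lemma p1_local:
  assumes K: "\<And>v. normn d v = 1 \<Longrightarrow>
      (\<integral>z. \<bar>p1 \<tau> d (\<lambda>i\<in>{..<d}. - v i + z i) - p1 \<tau> d z\<bar> \<partial>lebn d) \<le> K"
    and K0: "0 \<le> K" and w: "normn d w \<le> 1" and D: "0 \<le> D"
  shows "(\<integral>z. p1 \<tau> d z * (normn d w / (1 + \<bar>dotn d w z + b\<bar>)) \<partial>lebn d)
    \<le> 4 * ln (2 + D) * K + 2 / (1 + D)"
proof (cases "normn d w = 0")
  case True
  then show ?thesis using K0 D by (simp add: add_nonneg_nonneg)
next
  case False
  then have w0: "0 < normn d w" using L2_set_nonneg[of w "{..<d}"] by linarith
  define w' where "w' i = - w i" for i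
  have nw': "normn d w' = normn d w" by (simp add: w'_def L2_set_def)
  have dw': "dotn d w' z + - b = - (dotn d w z + b)" for z by (simp add: w'_def dotn_def sum_negf)
  let ?H = "\<lambda>w b z. p1 \<tau> d z * (if 0 \<le> dotn d w z + b then normn d w / (1 + (dotn d w z + b)) else 0)"
  have H: "integrable (lebn d) (?H w b)" if "normn d w \<le> 1" for w b
  proof (rule Bochner_Integration.integrable_bound[OF integrable_p1(1)[of d \<tau>]])
    have "\<bar>if 0 \<le> dotn d w z + b then normn d w / (1 + (dotn d w z + b)) else 0\<bar> \<le> 1" for z
      using that by (auto simp: divide_le_eq)
    then show "AE z in lebn d. norm (?H w b z) \<le> norm (p1 \<tau> d z)"
      using p1_nonneg[of \<tau> d] by (simp add: abs_mult mult_left_le)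
  qed measurable
  have "(\<integral>z. p1 \<tau> d z * (normn d w / (1 + \<bar>dotn d w z + b\<bar>)) \<partial>lebn d)
      \<le> (\<integral>z. ?H w b z + ?H w' (- b) z \<partial>lebn d)"
  proof (rule integral_mono)
    show "integrable (lebn d) (\<lambda>z. ?H w b z + ?H w' (- b) z)"
      using H[OF w] H[of w' "- b"] w nw' by auto
    show "integrable (lebn d) (\<lambda>z. p1 \<tau> d z * (normn d w / (1 + \<bar>dotn d w z + b\<bar>)))"
    proof (rule Bochner_Integration.integrable_bound[OF integrable_p1(1)[of d \<tau>]])
      have "\<bar>normn d w / (1 + \<bar>dotn d w z + b\<bar>)\<bar> \<le> 1" for z
        using w by (auto simp: divide_le_eq)
      then have "norm (p1 \<tau> d z * (normn d w / (1 + \<bar>dotn d w z + b\<bar>))) \<le> norm (p1 \<tau> d z)" for z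
        unfolding real_norm_def abs_mult[of "p1 \<tau> d z"] by (intro mult_left_le) auto
      then show "AE z in lebn d. norm (p1 \<tau> d z * (normn d w / (1 + \<bar>dotn d w z + b\<bar>))) \<le> norm (p1 \<tau> d z)"
        by simp
    qed measurable
    fix z
    show "p1 \<tau> d z * (normn d w / (1 + \<bar>dotn d w z + b\<bar>)) \<le> ?H w b z + ?H w' (- b) z"
      unfolding nw' dw' using p1_nonneg[of \<tau> d z]
      by (cases "dotn d w z + b" "0 :: real" rule: linorder_cases) auto
  qed
  also have "\<dots> = (\<integral>z. ?H w b z \<partial>lebn d) + (\<integral>z. ?H w' (- b) z \<partial>lebn d)"
    using H[OF w] H[of w' "- b"] w nw' by (intro Bochner_Integration.integral_add) auto
  also have "\<dots> \<le> (2 * ln (2 + D) * K + 1 / (1 + D)) + (2 * ln (2 + D) * K + 1 / (1 + D))"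
    using w0 w nw' D by (intro add_mono p1_half_local K) auto
  finally show ?thesis by (simp add: mult_ac)
qed

section \<open>One planar flow moves the target density only slightly\<close>

lemma diffn_imp_DERIV_line_aux:
  assumes G: "\<forall>e>0. \<exists>r>0. \<forall>y\<in>Rn d. normn d (\<lambda>i. y i - z i) < r \<longrightarrow>
        \<bar>g y - g z - dotn d G (\<lambda>i. y i - z i)\<bar> \<le> e * normn d (\<lambda>i. y i - z i)"
    and z: "z \<in> Rn d"
  shows "((\<lambda>t. g (\<lambda>i\<in>{..<d}. z i + t * v i)) has_real_derivative dotn d G v) (at 0)"
proof -
  let ?y = "\<lambda>t. \<lambda>i\<in>{..<d}. z i + t * v i"
  have y0: "?y 0 = z" using z by (intro Rn_eqI[of _ d]) (auto simp: Rn_def)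
  have yR: "?y t \<in> Rn d" for t by (simp add: Rn_def)
  have n: "normn d (\<lambda>i. ?y t i - z i) = \<bar>t\<bar> * normn d v" for t
    unfolding normn_scale[symmetric] by (rule L2_set_cong) auto
  have dt: "dotn d G (\<lambda>i. ?y t i - z i) = dotn d G v * t" for t
    by (simp add: dotn_def sum_distrib_left mult_ac)
  have "\<exists>r>0. \<forall>t. norm (t - 0) < r \<longrightarrow> norm (g (?y t) - g (?y 0) - dotn d G v * (t - 0)) \<le> e * norm (t - 0)"
    if e: "0 < e" for e
  proof -
    \<comment> \<open>The added 1 keeps the division by \<open>N\<close> legitimate when
      \<open>v\<close> is zero.\<close>
    define N where "N = normn d v + 1"
    have N: "0 < N" "normn d v \<le> N" by (simp_all add: N_def add_nonneg_pos)
    obtain r where r: "r > 0" "\<And>y. y \<in> Rn d \<Longrightarrow> normn d (\<lambda>i. y i - z i) < r \<Longrightarrow>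
        \<bar>g y - g z - dotn d G (\<lambda>i. y i - z i)\<bar> \<le> e / N * normn d (\<lambda>i. y i - z i)"
      using G[rule_format, of "e / N"] e N by auto
    have "norm (g (?y t) - g (?y 0) - dotn d G v * (t - 0)) \<le> e * norm (t - 0)" if t: "norm (t - 0) < r / N" for t
    proof -
      have le: "\<bar>t\<bar> * normn d v \<le> \<bar>t\<bar> * N" using N by (intro mult_left_mono) auto
      also have "\<dots> < r" using t N by (simp add: field_simps)
      finally have "\<bar>g (?y t) - g z - dotn d G v * t\<bar> \<le> e / N * (\<bar>t\<bar> * normn d v)"
        using r(2)[OF yR[of t]] unfolding n dt by simp
      also have "\<dots> \<le> e / N * (\<bar>t\<bar> * N)" using e N le by (intro mult_left_mono) auto
      finally show ?thesis using N unfolding y0 by simp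
    qed
    then show ?thesis using r N by (intro exI[of _ "r / N"]) auto
  qed
  then show ?thesis
    unfolding has_field_derivative_def has_derivative_at_alt by (auto intro: bounded_linear_mult_right)
qed

lemma diffn_gradient_eq_gradn:
  assumes G: "\<forall>e>0. \<exists>r>0. \<forall>y\<in>Rn d. normn d (\<lambda>i. y i - z i) < r \<longrightarrow>
        \<bar>g y - g z - dotn d G (\<lambda>i. y i - z i)\<bar> \<le> e * normn d (\<lambda>i. y i - z i)"
    and z: "z \<in> Rn d" and i: "i < d"
  shows "gradn d g z i = G i"
proof -
  have line: "(\<lambda>k\<in>{..<d}. z k + t * (if k = i then 1 else 0)) = z(i := z i + t)" for t
    using z i by (intro Rn_eqI[of _ d]) (auto simp: Rn_def PiE_iff extensional_def)
  have "((\<lambda>t. g (z(i := z i + t))) has_real_derivative dotn d G (\<lambda>k. if k = i then 1 else 0)) (at 0)"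
    using diffn_imp_DERIV_line_aux[OF G z, of "\<lambda>k. if k = i then 1 else 0"] unfolding line .
  moreover have "dotn d G (\<lambda>k. if k = i then 1 else 0) = G i"
    using i by (simp add: dotn_def if_distrib[where f="\<lambda>x. _ * x"] cong: if_cong)
  ultimately have "((\<lambda>t. g (z(i := t))) has_real_derivative G i) (at (z i))"
    using DERIV_shift[of "\<lambda>t. g (z(i := t))" "G i" 0 "z i"] by (simp add: add.commute)
  then show ?thesis using i by (simp add: gradn_def DERIV_imp_deriv)
qed

lemma diffn_imp_DERIV_line:
  assumes g: "diffn d g z" and z: "z \<in> Rn d"
  shows "((\<lambda>t. g (\<lambda>i\<in>{..<d}. z i + t * v i)) has_real_derivative dotn d (gradn d g z) v) (at 0)"
proof -
  obtain G where G: "\<forall>e>0. \<exists>r>0. \<forall>y\<in>Rn d. normn d (\<lambda>i. y i - z i) < r \<longrightarrow>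
        \<bar>g y - g z - dotn d G (\<lambda>i. y i - z i)\<bar> \<le> e * normn d (\<lambda>i. y i - z i)"
    using g unfolding diffn_def by blast
  have "dotn d (gradn d g z) v = dotn d G v"
    unfolding dotn_def using diffn_gradient_eq_gradn[OF G z] by (intro sum.cong) auto
  with diffn_imp_DERIV_line_aux[OF G z] show ?thesis by simp
qed

text \<open>The one-variable mean value theorem along the segment from \<open>z\<close> to
  \<open>y\<close>. The hypothesis is stated on a ball because, for a flow, only the length of the
  displacement is under control.\<close>

lemma diffn_mean_value:
  assumes z: "z \<in> Rn d" and y: "y \<in> Rn d"
    and g: "\<And>x. x \<in> Rn d \<Longrightarrow> normn d (\<lambda>i. x i - z i) \<le> normn d (\<lambda>i. y i - z i) \<Longrightarrow>
      diffn d g x \<and> normn d (gradn d g x) \<le> M"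
  shows "\<bar>g y - g z\<bar> \<le> M * normn d (\<lambda>i. y i - z i)"
proof -
  define v where "v = (\<lambda>i. y i - z i)"
  define x where "x t = (\<lambda>i\<in>{..<d}. z i + t * v i)" for t
  have xR: "x t \<in> Rn d" for t by (simp add: x_def Rn_def)
  have nx: "normn d (\<lambda>i. x t i - z i) = \<bar>t\<bar> * normn d v" for t
    unfolding normn_scale[symmetric] by (rule L2_set_cong) (auto simp: x_def)
  have gx: "diffn d g (x t) \<and> normn d (gradn d g (x t)) \<le> M" if "0 \<le> t" "t \<le> 1" for t
    using that by (intro g xR) (simp add: nx mult_left_le_one_le flip: v_def)
  have x0: "x 0 = z" "x 1 = y"
    using z y by (auto intro!: Rn_eqI[of _ d] simp: x_def v_def Rn_def)
  have D: "((\<lambda>t. g (x t)) has_real_derivative dotn d (gradn d g (x t)) v) (at t)" if "0 \<le> t" "t \<le> 1" for t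
  proof -
    have "(\<lambda>i\<in>{..<d}. x t i + s * v i) = x (s + t)" for s
      by (rule Rn_eqI[of _ d]) (auto simp: x_def Rn_def algebra_simps)
    then have "((\<lambda>s. g (x (s + t))) has_real_derivative dotn d (gradn d g (x t)) v) (at 0)"
      using diffn_imp_DERIV_line[OF conjunct1[OF gx[OF that]] xR, of v] by simp
    then show ?thesis using DERIV_shift[of "\<lambda>t. g (x t)" _ 0 t] by simp
  qed
  obtain t where t: "0 < t" "t < 1" "g (x 1) - g (x 0) = (1 - 0) * dotn d (gradn d g (x t)) v"
    using MVT2[of 0 1 "\<lambda>t. g (x t)" "\<lambda>t. dotn d (gradn d g (x t)) v"] D by auto
  then have "\<bar>g y - g z\<bar> = \<bar>dotn d (gradn d g (x t)) v\<bar>" by (simp add: x0)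
  also have "\<dots> \<le> normn d (gradn d g (x t)) * normn d v" by (rule abs_dotn_le)
  also have "\<dots> \<le> M * normn d v" using gx[of t] t by (intro mult_right_mono) auto
  finally show ?thesis by (simp only: v_def)
qed

text \<open>The squared norm is a polynomial, so its expansion has an exact quadratic remainder, and
  only a derivative in one variable is left. The representation is restricted to norms above
  \<open>\<rho>\<close> because \<open>p2\<close> follows another formula inside.\<close>

lemma gradient_radial:
  assumes \<psi>: "(\<psi> has_real_derivative D) (at ((normn d z)\<^sup>2))"
    and g: "\<And>y. \<rho> < normn d y \<Longrightarrow> g y = \<psi> ((normn d y)\<^sup>2)"
    and z: "z \<in> Rn d" "\<rho> < normn d z"
  shows "diffn d g z" "normn d (gradn d g z) = 2 * \<bar>D\<bar> * normn d z"
proof -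
  let ?n = "\<lambda>y. normn d (\<lambda>i. y i - z i)"
  have G: "\<exists>r>0. \<forall>y\<in>Rn d. ?n y < r \<longrightarrow>
        \<bar>g y - g z - dotn d (\<lambda>i. 2 * D * z i) (\<lambda>i. y i - z i)\<bar> \<le> e * ?n y" if e: "0 < e" for e
  proof -
    define N where "N = 2 * normn d z + 1"
    have N: "1 \<le> N" by (simp add: N_def)
    define e' where "e' = e / (2 * N)"
    have e': "0 < e'" using e N by (simp add: e'_def)
    obtain r0 where r0: "r0 > 0" "\<And>s. \<bar>s - (normn d z)\<^sup>2\<bar> < r0 \<Longrightarrow>
        \<bar>\<psi> s - \<psi> ((normn d z)\<^sup>2) - D * (s - (normn d z)\<^sup>2)\<bar> \<le> e' * \<bar>s - (normn d z)\<^sup>2\<bar>"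
      using \<psi> e' unfolding has_field_derivative_def has_derivative_at_alt real_norm_def by blast
    \<comment> \<open>In order: distance below 1 makes the change of the squared norm at most
      \<open>N * k\<close>; \<open>r0 / N\<close> then keeps it in the range of the derivative of
      \<open>\<psi>\<close>; the third bound keeps \<open>y\<close> outside radius
      \<open>\<rho>\<close>; the last one bounds the quadratic remainder
      \<open>D * k\<^sup>2\<close> by \<open>e / 2 * k\<close>.\<close>
    define r where "r = min (min 1 (r0 / N)) (min (normn d z - \<rho>) (e / (2 * (\<bar>D\<bar> + 1))))"
    have "0 < r" using r0 N z e by (simp add: r_def)
    moreover have "\<bar>g y - g z - dotn d (\<lambda>i. 2 * D * z i) (\<lambda>i. y i - z i)\<bar> \<le> e * ?n y"
      if y: "y \<in> Rn d" and near: "?n y < r" for y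
    proof -
      define k where "k = ?n y"
      have k: "0 \<le> k" "k < 1" "k < r0 / N" "k < normn d z - \<rho>" "k < e / (2 * (\<bar>D\<bar> + 1))"
        using near by (auto simp: k_def r_def)
      have "\<rho> < normn d y"
        using k normn_diff_le[where x=y and y=z and d=d] by (simp add: k_def)
      then have gy: "g y = \<psi> ((normn d y)\<^sup>2)" and gz: "g z = \<psi> ((normn d z)\<^sup>2)"
        using g z by auto
      define c where "c = dotn d z (\<lambda>i. y i - z i)"
      have c: "\<bar>c\<bar> \<le> normn d z * k" unfolding c_def k_def by (rule abs_dotn_le)
      have "(normn d y)\<^sup>2 = (\<Sum>i<d. (z i)\<^sup>2 + 2 * (z i * (y i - z i)) + (y i - z i)\<^sup>2)"
        unfolding normn_sq by (intro sum.cong) (auto simp: power2_eq_square algebra_simps)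
      then have s: "(normn d y)\<^sup>2 - (normn d z)\<^sup>2 = 2 * c + k\<^sup>2"
        unfolding k_def normn_sq c_def dotn_def by (simp add: sum.distrib sum_distrib_left)
      have "k\<^sup>2 \<le> k" using k by (simp add: power2_eq_square mult_left_le)
      then have "\<bar>2 * c + k\<^sup>2\<bar> \<le> 2 * (normn d z * k) + k"
        using c zero_le_power2[of k] by linarith
      then have abs_s: "\<bar>2 * c + k\<^sup>2\<bar> \<le> N * k" by (simp add: N_def algebra_simps)
      also have "\<dots> < r0" using k N by (simp add: field_simps)
      finally have "\<bar>g y - g z - D * (2 * c + k\<^sup>2)\<bar> \<le> e' * \<bar>2 * c + k\<^sup>2\<bar>"
        using r0(2)[of "(normn d y)\<^sup>2"] by (simp add: gy gz s)
      also have "\<dots> \<le> e' * (N * k)" using abs_s e' by (intro mult_left_mono) auto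
      also have "\<dots> = e / 2 * k" using N by (simp add: e'_def)
      finally have 1: "\<bar>g y - g z - D * (2 * c + k\<^sup>2)\<bar> \<le> e / 2 * k" .
      have "\<bar>D\<bar> * k \<le> (\<bar>D\<bar> + 1) * k" using k by (intro mult_right_mono) auto
      also have "\<dots> \<le> e / 2" using k by (simp add: field_simps)
      finally have "\<bar>D\<bar> * k * k \<le> e / 2 * k" using k by (intro mult_right_mono) auto
      then have 2: "\<bar>D * k\<^sup>2\<bar> \<le> e / 2 * k" by (simp add: abs_mult power2_eq_square mult_ac)
      have "dotn d (\<lambda>i. 2 * D * z i) (\<lambda>i. y i - z i) = D * (2 * c + k\<^sup>2) - D * k\<^sup>2"
        by (simp add: c_def dotn_def sum_distrib_left algebra_simps)
      then show ?thesis using 1 2 unfolding k_def[symmetric] by linarith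
    qed
    ultimately show ?thesis by blast
  qed
  then show "diffn d g z" unfolding diffn_def by blast
  have "normn d (gradn d g z) = normn d (\<lambda>i. 2 * D * z i)"
    using G z by (intro L2_set_cong refl diffn_gradient_eq_gradn) auto
  then show "normn d (gradn d g z) = 2 * \<bar>D\<bar> * normn d z"
    unfolding normn_scale abs_mult by simp
qed

text \<open>At radius \<open>r\<close> the logarithmic gradient is
  \<open>\<tau> * r powr (\<tau> - 1)\<close>. It decreases in \<open>r\<close> as
  \<open>\<tau> < 1\<close>, so its size at the sphere bounds it everywhere outside.\<close>

lemma p2_gradient:
  assumes \<tau>: "0 < \<tau>" "\<tau> < 1" and d: "0 < d" and z: "z \<in> Rn d" "real d powr (1 / \<tau>) < normn d z"
  shows "diffn d (p2 \<tau> d) z"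
    and "normn d (gradn d (p2 \<tau> d) z) \<le> real d powr (1 - 1 / \<tau>) * p2 \<tau> d z"
proof -
  define Z where "Z = (\<integral>z. (if normn d z \<le> real d powr (1 / \<tau>) then exp (- real d)
    else exp (- (normn d z powr \<tau>))) \<partial>lebn d)"
  define r where "r = normn d z"
  have R0: "0 < real d powr (1 / \<tau>)" using d by simp
  then have r: "0 < r" using z(2) unfolding r_def by linarith
  \<comment> \<open>The exponent is halved because \<open>\<psi>\<close> takes the squared norm as
    its argument.\<close>
  define \<psi> where "\<psi> s = exp (- (s powr (\<tau> / 2))) / Z" for s
  have sq: "(x\<^sup>2) powr a = x powr (2 * a)" if "0 < x" for x a :: real
    using that powr_powr[of x 2 a] by (simp add: powr_numeral)
  have p2: "p2 \<tau> d y = \<psi> ((normn d y)\<^sup>2)" if "real d powr (1 / \<tau>) < normn d y" for y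
  proof -
    have "0 < normn d y" using that R0 by linarith
    with that sq[of "normn d y" "\<tau> / 2"] show ?thesis
      by (simp add: p2_def normalized_def \<psi>_def Z_def)
  qed
  define D where "D = exp (- ((r\<^sup>2) powr (\<tau> / 2))) * (- (\<tau> / 2 * (r\<^sup>2) powr (\<tau> / 2 - 1))) / Z"
  have "(\<psi> has_real_derivative D) (at (r\<^sup>2))"
    unfolding \<psi>_def[abs_def] D_def using r
    by (intro DERIV_cdivide) (auto intro!: derivative_eq_intros simp: powr_diff field_simps)
  note grad = gradient_radial[OF this[unfolded r_def] p2 z]
  show "diffn d (p2 \<tau> d) z" by (rule grad(1))
  have Z: "0 \<le> Z" unfolding Z_def by (intro Bochner_Integration.integral_nonneg) auto
  have "(r\<^sup>2) powr (\<tau> / 2 - 1) = r powr (\<tau> - 2)"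
    using sq[OF r, of "\<tau> / 2 - 1"] by (simp add: right_diff_distrib)
  then have rD: "(r\<^sup>2) powr (\<tau> / 2 - 1) * r = r powr (\<tau> - 1)"
    using powr_add[of r "\<tau> - 2" 1] r by simp
  have "2 * \<bar>D\<bar> * r = \<tau> * ((r\<^sup>2) powr (\<tau> / 2 - 1) * r) * \<psi> (r\<^sup>2)"
    using Z \<tau> by (simp add: D_def \<psi>_def abs_mult)
  also have "\<dots> = \<tau> * r powr (\<tau> - 1) * p2 \<tau> d z"
    using p2[OF z(2)] unfolding rD by (simp only: r_def)
  also have "\<dots> \<le> real d powr (1 - 1 / \<tau>) * p2 \<tau> d z"
  proof (rule mult_right_mono)
    have "\<tau> * r powr (\<tau> - 1) \<le> 1 * r powr (\<tau> - 1)" using \<tau> by (intro mult_right_mono) auto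
    also have "1 * r powr (\<tau> - 1) \<le> (real d powr (1 / \<tau>)) powr (\<tau> - 1)"
      using \<tau> z R0 by (simp add: r_def powr_mono2')
    also have "\<dots> = real d powr (1 - 1 / \<tau>)"
      using \<tau> by (simp add: powr_powr diff_divide_distrib)
    finally show "\<tau> * r powr (\<tau> - 1) \<le> real d powr (1 - 1 / \<tau>)" .
  qed (rule p2_nonneg[OF \<tau>(1)])
  finally show "normn d (gradn d (p2 \<tau> d) z) \<le> real d powr (1 - 1 / \<tau>) * p2 \<tau> d z"
    using grad(2) by (simp add: r_def)
qed

text \<open>The three summands are the mass of the ball, the motion of \<open>p\<close> along its
  gradient, and the Jacobian. A flow moves points by at most \<open>c\<close>, since
  \<open>h\<close> is bounded by \<open>c\<close> and \<open>u\<close> by 1; \<open>E\<close> is the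
  price of comparing densities at that distance.\<close>

lemma L1_norm_push_density_le:
  fixes p :: "(nat \<Rightarrow> real) \<Rightarrow> real"
  assumes \<tau>: "0 < \<tau>" "\<tau> < 1" and d: "0 < d"
    and p: "is_density d p" and Cp: "0 \<le> Cp" "\<And>z. z \<in> Rn d \<Longrightarrow> p z \<le> Cp * p1 \<tau> d z"
    and Cg: "0 \<le> Cg" "\<And>z. z \<in> Rn d \<Longrightarrow> diffn d (p2 \<tau> d) z \<Longrightarrow>
       diffn d p z \<and> normn d (gradn d p z) \<le> Cg * normn d (gradn d (p2 \<tau> d) z)"
    and f: "f \<in> local_planar_flows d c"
  defines "R \<equiv> real d powr (1 / \<tau>)" and "E \<equiv> exp (c powr \<tau>)"
  assumes KA: "(\<integral>z. p1 \<tau> d z * indicator {z. normn d z \<le> R + c} z \<partial>lebn d) \<le> KA"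
    and KB: "\<And>w b. normn d w \<le> 1 \<Longrightarrow>
      (\<integral>z. p1 \<tau> d z * (normn d w / (1 + \<bar>dotn d w z + b\<bar>)) \<partial>lebn d) \<le> KB"
  shows "L1_norm d (\<lambda>z. push_density d f p z - p z)
    \<le> Cp * (1 + E) * KA + Cg * c * E * real d powr (1 - 1 / \<tau>) + Cp * E * c * KB"
proof -
  obtain u w b h h' where pl: "f = planar_map d u w b h" and bij: "bij_betw f (Rn d) (Rn d)"
    and h: "\<And>x. (h has_real_derivative h' x) (at x)"
    and hc: "\<And>x. \<bar>h x\<bar> \<le> c" "\<And>x. \<bar>h' x\<bar> \<le> c / (1 + \<bar>x\<bar>)"
    and u: "normn d u \<le> 1" and w: "normn d w \<le> 1" and c: "0 \<le> c"
    using local_planar_flowsE[OF f] by metis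
  have pm[measurable]: "p \<in> borel_measurable (lebn d)" and p0: "\<And>z. z \<in> Rn d \<Longrightarrow> 0 \<le> p z"
    and pint: "integrable (lebn d) p" using p by (auto simp: is_density_def)
  have E: "0 < E" by (simp add: E_def)
  have near: "normn d (\<lambda>i. f z i - z i) \<le> c" if "z \<in> Rn d" for z
  proof -
    have "normn d (\<lambda>i. f z i - z i) = normn d (\<lambda>i. h (dotn d w z + b) * u i)"
      by (rule L2_set_cong) (auto simp: pl planar_map_def)
    also have "\<dots> \<le> c * 1" unfolding normn_scale using hc u c by (intro mult_mono) auto
    finally show ?thesis by simp
  qed
  define A where "A z = p1 \<tau> d z * indicator {z. normn d z \<le> R + c} z" for z
  define B where "B z = p1 \<tau> d z * (normn d w / (1 + \<bar>dotn d w z + b\<bar>))" for z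
  define k where "k = Cg * c * E * real d powr (1 - 1 / \<tau>)"
  have k0: "0 \<le> k" using Cg c E by (simp add: k_def)
  have A0: "0 \<le> A z" for z using p1_nonneg by (simp add: A_def)
  have pf: "p (f z) \<le> Cp * E * p1 \<tau> d z" if z: "z \<in> Rn d" for z
  proof -
    have "p (f z) \<le> Cp * p1 \<tau> d (f z)" by (intro Cp) (simp add: pl)
    also have "\<dots> \<le> Cp * (E * p1 \<tau> d z)"
      unfolding E_def using near[OF z] normn_diff_le[where d=d and x="f z" and y=z] Cp
      by (intro mult_left_mono p1_shift \<tau>) auto
    finally show ?thesis by simp
  qed
  have move: "\<bar>p z - p (f z)\<bar> \<le> Cp * (1 + E) * A z + k * p2 \<tau> d z" if z: "z \<in> Rn d" for z
  proof (cases "normn d z \<le> R + c")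
    case True
    have "\<bar>p z - p (f z)\<bar> \<le> p z + p (f z)"
      using p0[OF z] p0[of "f z"] by (simp add: pl)
    also have "\<dots> \<le> Cp * p1 \<tau> d z + Cp * E * p1 \<tau> d z" by (intro add_mono Cp pf z)
    also have "\<dots> = Cp * (1 + E) * A z" using True by (simp add: A_def algebra_simps)
    finally show ?thesis using k0 p2_nonneg[OF \<tau>(1), of d z] by (simp add: add_increasing2)
  next
    case False
    define M where "M = Cg * (real d powr (1 - 1 / \<tau>) * (E * p2 \<tau> d z))"
    have "\<bar>p (f z) - p z\<bar> \<le> M * normn d (\<lambda>i. f z i - z i)"
    proof (rule diffn_mean_value[OF z])
      show "f z \<in> Rn d" by (simp add: pl)
      \<comment> \<open>Points as close to \<open>z\<close> as \<open>f z\<close> still have norm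
        above \<open>R\<close>, where \<open>p2\<close> is differentiable and the gradient
        hypothesis applies; this is the purpose of the margin \<open>c\<close> in the
        radius.\<close>
      fix x assume x: "x \<in> Rn d" "normn d (\<lambda>i. x i - z i) \<le> normn d (\<lambda>i. f z i - z i)"
      then have xz: "\<bar>normn d x - normn d z\<bar> \<le> c"
        using near[OF z] normn_diff_le[where d=d and x=x and y=z] by linarith
      then have "real d powr (1 / \<tau>) < normn d x" using False by (simp add: R_def)
      note p2x = p2_gradient[OF \<tau> d x(1) this]
      have "normn d (gradn d p x) \<le> Cg * normn d (gradn d (p2 \<tau> d) x)"
        using Cg(2)[OF x(1) p2x(1)] by simp
      also have "\<dots> \<le> Cg * (real d powr (1 - 1 / \<tau>) * p2 \<tau> d x)"
        using Cg by (intro mult_left_mono p2x)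
      also have "\<dots> \<le> M"
        unfolding M_def E_def using Cg xz by (intro mult_left_mono p2_shift \<tau>) auto
      finally show "diffn d p x \<and> normn d (gradn d p x) \<le> M"
        using Cg(2)[OF x(1) p2x(1)] by simp
    qed
    also have "\<dots> \<le> M * c"
      using near[OF z] Cg E p2_nonneg[OF \<tau>(1), of d z] by (intro mult_left_mono) (auto simp: M_def)
    also have "\<dots> = k * p2 \<tau> d z" by (simp add: M_def k_def)
    finally show ?thesis using Cp E A0[of z]
      by (simp add: abs_minus_commute add_increasing)
  qed
  \<comment> \<open>Cauchy-Schwarz bounds only \<open>u\<close> by 1 here; \<open>normn d w\<close>
    is kept, because the averaged bound \<open>KB\<close> has it in the numerator.\<close>
  have J: "\<bar>\<bar>Determinant.det (jacobian d f z)\<bar> - 1\<bar> \<le> c * (normn d w / (1 + \<bar>dotn d w z + b\<bar>))" for z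
  proof -
    have "\<bar>\<bar>Determinant.det (jacobian d f z)\<bar> - 1\<bar> \<le> \<bar>dotn d w u * h' (dotn d w z + b)\<bar>"
      unfolding pl det_jacobian_planar_map[OF h] by linarith
    also have "\<dots> \<le> (normn d w * 1) * (c / (1 + \<bar>dotn d w z + b\<bar>))"
      unfolding abs_mult
      by (intro mult_mono hc order_trans[OF abs_dotn_le mult_left_mono[OF u]]) auto
    finally show ?thesis by (simp add: mult_ac)
  qed
  have pt: "\<bar>p z - p (f z) * \<bar>Determinant.det (jacobian d f z)\<bar>\<bar>
      \<le> Cp * (1 + E) * A z + k * p2 \<tau> d z + Cp * E * c * B z" if z: "z \<in> Rn d" for z
  proof -
    have "\<bar>p z - p (f z) * \<bar>Determinant.det (jacobian d f z)\<bar>\<bar>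
        = \<bar>(p z - p (f z)) - p (f z) * (\<bar>Determinant.det (jacobian d f z)\<bar> - 1)\<bar>"
      by (simp add: algebra_simps)
    also have "\<dots> \<le> \<bar>p z - p (f z)\<bar> + p (f z) * \<bar>\<bar>Determinant.det (jacobian d f z)\<bar> - 1\<bar>"
    proof -
      have "p (f z) * \<bar>x\<bar> = \<bar>p (f z) * x\<bar>" for x
        using p0[of "f z"] by (simp add: abs_mult pl)
      then show ?thesis by (simp only: abs_triangle_ineq4)
    qed
    also have "\<dots> \<le> (Cp * (1 + E) * A z + k * p2 \<tau> d z)
        + (Cp * E * p1 \<tau> d z) * (c * (normn d w / (1 + \<bar>dotn d w z + b\<bar>)))"
      using p1_nonneg[of \<tau> d z] Cp E by (intro add_mono mult_mono move pf z J) auto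
    also have "\<dots> = Cp * (1 + E) * A z + k * p2 \<tau> d z + Cp * E * c * B z"
      by (simp add: B_def mult_ac)
    finally show ?thesis .
  qed
  have intA: "integrable (lebn d) A"
  proof (rule Bochner_Integration.integrable_bound[OF integrable_p1(1)[of d \<tau>]])
    have "A = (\<lambda>z. if normn d z \<le> R + c then p1 \<tau> d z else 0)" by (auto simp: A_def fun_eq_iff)
    then show "A \<in> borel_measurable (lebn d)" by simp
    show "AE z in lebn d. norm (A z) \<le> norm (p1 \<tau> d z)"
      using p1_nonneg by (auto simp: A_def indicator_def)
  qed
  have intB: "integrable (lebn d) B"
  proof (rule Bochner_Integration.integrable_bound[OF integrable_p1(1)[of d \<tau>]])
    show "B \<in> borel_measurable (lebn d)" unfolding B_def[abs_def] by measurable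
    have "\<bar>normn d w / (1 + \<bar>dotn d w z + b\<bar>)\<bar> \<le> 1" for z
      using w by (auto simp: divide_le_eq)
    then have "norm (B z) \<le> norm (p1 \<tau> d z)" for z
      unfolding B_def real_norm_def abs_mult[of "p1 \<tau> d z"] by (intro mult_left_le) auto
    then show "AE z in lebn d. norm (B z) \<le> norm (p1 \<tau> d z)" by simp
  qed
  let ?b = "\<lambda>z. Cp * (1 + E) * A z + k * p2 \<tau> d z + Cp * E * c * B z"
  have intb: "integrable (lebn d) ?b" using intA intB integrable_p2[OF \<tau>(1)] by auto
  have b0: "0 \<le> ?b z" if "z \<in> Rn d" for z using pt[OF that] by linarith
  have "ennreal (L1_norm d (\<lambda>z. push_density d f p z - p z))
      = (\<integral>\<^sup>+z. ennreal \<bar>p z - p (f z) * \<bar>Determinant.det (jacobian d f z)\<bar>\<bar> \<partial>lebn d)"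
    using pint integrable_push_density[OF f pint]
    by (simp add: nn_integral_eq_L1_norm[symmetric] nn_integral_push_density[OF f pm pm])
  also have "\<dots> \<le> (\<integral>\<^sup>+z. ennreal (?b z) \<partial>lebn d)"
    using pt by (intro nn_integral_mono ennreal_leI) (auto simp: space_lebn)
  also have "\<dots> = ennreal (\<integral>z. ?b z \<partial>lebn d)"
    using b0 by (intro nn_integral_eq_integral intb AE_I2) (auto simp: space_lebn)
  finally have "L1_norm d (\<lambda>z. push_density d f p z - p z) \<le> (\<integral>z. ?b z \<partial>lebn d)"
    using b0 by (subst (asm) ennreal_le_iff) (auto intro!: integral_nonneg_AE AE_I2 simp: space_lebn)
  also have "\<dots> = Cp * (1 + E) * (\<integral>z. A z \<partial>lebn d) + k * (\<integral>z. p2 \<tau> d z \<partial>lebn d) + Cp * E * c * (\<integral>z. B z \<partial>lebn d)"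
    using intA intB integrable_p2(1)[OF \<tau>(1), of d] by simp
  also have "\<dots> \<le> Cp * (1 + E) * KA + k * 1 + Cp * E * c * KB"
    using Cp E c k0 integrable_p2(2)[OF \<tau>(1), of d] KA KB[OF w, of b]
    by (intro add_mono mult_left_mono) (auto simp: A_def B_def)
  finally show ?thesis by (simp add: k_def)
qed

section \<open>The lower bound\<close>

text \<open>With dilation parameter \<open>x\<close> and \<open>\<rho> powr \<tau> = d\<close>, the
  bound of \<open>p1_small_ball\<close> decays at rate \<open>ln x / \<tau> - (x - 1)\<close> in
  \<open>d\<close>. This is its maximum, attained at \<open>x = 1 / \<tau>\<close>.\<close>

definition ball_decay_rate :: "real \<Rightarrow> real" where
  "ball_decay_rate \<tau> = ln (1 / \<tau>) / \<tau> - (1 / \<tau> - 1)"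

lemma ball_decay_rate_pos:
  assumes "0 < \<tau>" "\<tau> < 1"
  shows "0 < ball_decay_rate \<tau>"
proof -
  have "ln \<tau> < \<tau> - 1"
    using ln_le_minus_one[of \<tau>] ln_eq_minus_one[of \<tau>] assms by fastforce
  then have "(1 - \<tau>) / \<tau> < ln (1 / \<tau>) / \<tau>"
    using divide_strict_right_mono[of "1 - \<tau>" "- ln \<tau>" \<tau>] assms by (simp add: ln_div)
  then show ?thesis using assms by (simp add: ball_decay_rate_def diff_divide_distrib)
qed

text \<open>Enlarging the radius by \<open>c\<close> raises its \<open>\<tau>\<close>-th power by at
  most \<open>c powr \<tau>\<close>, which costs only a factor independent of
  \<open>d\<close>.\<close>

lemma p1_ball_decay:
  assumes \<tau>: "0 < \<tau>" "\<tau> < 1" and c: "0 \<le> c" and d: "0 < d"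
  shows "(\<integral>z. p1 \<tau> d z * indicator {z. normn d z \<le> real d powr (1 / \<tau>) + c} z \<partial>lebn d)
    \<le> exp ((1 / \<tau> - 1) * c powr \<tau>) * exp (- ball_decay_rate \<tau> * real d)"
proof -
  define R where "R = real d powr (1 / \<tau>)"
  have R: "0 \<le> R" "R powr \<tau> = real d" using \<tau> by (auto simp: R_def powr_powr)
  have x: "1 < 1 / \<tau>" using \<tau> by simp
  have "(R + c) powr \<tau> \<le> real d + c powr \<tau>"
    using powr_diff_le[of "R + c" R c \<tau>] R c \<tau> by simp
  then have "(1 / \<tau> - 1) * (R + c) powr \<tau> \<le> (1 / \<tau> - 1) * (real d + c powr \<tau>)"
    using x by (intro mult_left_mono) auto
  moreover have "(1 / \<tau>) powr (- real d / \<tau>) = exp (- (ln (1 / \<tau>) / \<tau>) * real d)"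
    using \<tau> by (simp add: powr_def mult_ac)
  ultimately have "(1 / \<tau>) powr (- real d / \<tau>) * exp ((1 / \<tau> - 1) * (R + c) powr \<tau>)
      \<le> exp (- (ln (1 / \<tau>) / \<tau>) * real d) * exp ((1 / \<tau> - 1) * (real d + c powr \<tau>))"
    by (simp only: mult_left_mono exp_le_cancel_iff exp_ge_zero)
  also have "\<dots> = exp ((1 / \<tau> - 1) * c powr \<tau>) * exp (- ball_decay_rate \<tau> * real d)"
    unfolding exp_add[symmetric] ball_decay_rate_def by (simp add: algebra_simps)
  finally show ?thesis
    using p1_small_ball[OF \<tau>(1) x, of "R + c" d] R c by (simp add: R_def)
qed

text \<open>The gradient term sets the order. The ball is exponentially small, and the Jacobian
  contributes \<open>ln d * d powr (1 / 2 - 1 / \<tau>)\<close>, which is smaller because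
  \<open>ln d\<close> grows more slowly than \<open>sqrt d\<close>.\<close>

lemma eventually_flow_displacement:
  fixes \<tau> c :: real
  assumes \<tau>: "0 < \<tau>" "\<tau> < 1"
    and p: "\<And>d. d > 2 \<Longrightarrow> is_density d (p d)"
    and Cp: "0 \<le> Cp" "\<forall>\<^sub>F d in sequentially. \<forall>z\<in>Rn d. p d z \<le> Cp * p1 \<tau> d z"
    and Cg: "0 \<le> Cg" "\<forall>\<^sub>F d in sequentially. \<forall>z\<in>Rn d. diffn d (p2 \<tau> d) z \<longrightarrow>
       diffn d (p d) z \<and> normn d (gradn d (p d) z) \<le> Cg * normn d (gradn d (p2 \<tau> d) z)"
  obtains K where "0 < K" "\<forall>\<^sub>F d in sequentially. \<forall>f\<in>local_planar_flows d c.
    L1_norm d (\<lambda>z. push_density d f (p d) z - p d z) \<le> K * real d powr (1 - 1 / \<tau>)"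
proof (cases "0 \<le> c")
  case False
  \<comment> \<open>A negative \<open>c\<close> cannot bound an absolute value, so there is no flow
    and any positive constant serves.\<close>
  then have "local_planar_flows d c = {}" for d
    using local_planar_flowsE[of _ d c] by (metis all_not_in_conv)
  then show ?thesis by (intro that[of 1]) auto
next
  case c: True
  define \<gamma> where "\<gamma> = ball_decay_rate \<tau>"
  have \<gamma>: "0 < \<gamma>" unfolding \<gamma>_def by (rule ball_decay_rate_pos[OF \<tau>])
  define M where "M a = exp ((1 / \<tau> - 1) * a powr \<tau>)" for a
  have M: "0 < M a" for a by (simp add: M_def)
  define KT where "KT = (exp 1 + 1) * M 1 + 3 * exp 1"
  have KT: "0 < KT" using M[of 1] by (simp add: KT_def add_pos_pos)
  define E where "E = exp (c powr \<tau>)"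
  have E: "0 < E" by (simp add: E_def)
  \<comment> \<open>The final 1 keeps \<open>K\<close> positive even if \<open>Cp\<close> and
    \<open>Cg\<close> are 0.\<close>
  define K where "K = Cp * (1 + E) * M c + Cg * c * E + Cp * E * c * (4 * KT + 2) + 1"
  have K: "0 < K"
    unfolding K_def using Cp Cg c E M[of c] KT by (intro add_nonneg_pos add_nonneg_nonneg mult_nonneg_nonneg) auto
  have asym:
    "\<forall>\<^sub>F d::nat in sequentially. exp (- \<gamma> * real d) \<le> real d powr (1 / 2 - 1 / \<tau>)"
    "\<forall>\<^sub>F d::nat in sequentially. exp (- \<gamma> * real d) \<le> real d powr (1 - 1 / \<tau>)"
    "\<forall>\<^sub>F d::nat in sequentially. ln (2 + real d powr (1 / \<tau>)) * real d powr (1 / 2 - 1 / \<tau>) \<le> real d powr (1 - 1 / \<tau>)"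
    "\<forall>\<^sub>F d::nat in sequentially. 1 / (1 + real d powr (1 / \<tau>)) \<le> real d powr (1 - 1 / \<tau>)"
    using \<tau> \<gamma> by real_asymp+
  have "\<forall>\<^sub>F d in sequentially. \<forall>f\<in>local_planar_flows d c.
    L1_norm d (\<lambda>z. push_density d f (p d) z - p d z) \<le> K * real d powr (1 - 1 / \<tau>)"
    using asym Cp(2) Cg(2) eventually_gt_at_top[of 2]
  proof eventually_elim
    case (elim d)
    then have d: "2 < d" "0 < d" by auto
    define a where "a = real d powr (1 - 1 / \<tau>)"
    define t where "t = real d powr (1 / 2 - 1 / \<tau>)"
    \<comment> \<open>A polynomial clamp: the tail \<open>2 / (1 + D)\<close> falls below the target
      order, while \<open>ln (2 + D)\<close> stays of order \<open>ln d\<close>.\<close>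
    define D where "D = real d powr (1 / \<tau>)"
    have D: "0 \<le> D" by (simp add: D_def)
    have TV: "(\<integral>z. \<bar>p1 \<tau> d (\<lambda>i\<in>{..<d}. - v i + z i) - p1 \<tau> d z\<bar> \<partial>lebn d) \<le> KT * t"
      if v: "normn d v = 1" for v
    proof -
      have "(\<integral>z. p1 \<tau> d z * indicator {z. normn d z \<le> real d powr (1 / \<tau>) + 1} z \<partial>lebn d) \<le> M 1 * exp (- \<gamma> * real d)"
        unfolding M_def \<gamma>_def by (rule p1_ball_decay[OF \<tau> _ d(2)]) simp
      also have "\<dots> \<le> M 1 * t" using elim M[of 1] by (intro mult_left_mono) (auto simp: t_def)
      finally have "(exp 1 + 1) * (\<integral>z. p1 \<tau> d z * indicator {z. normn d z \<le> real d powr (1 / \<tau>) + 1} z \<partial>lebn d)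
          \<le> (exp 1 + 1) * (M 1 * t)"
        by (rule mult_left_mono) (simp add: add_nonneg_nonneg)
      then show ?thesis
        using p1_translation_L1[OF \<tau> d(2) v] by (simp add: KT_def t_def distrib_right)
    qed
    have KB: "(\<integral>z. p1 \<tau> d z * (normn d w / (1 + \<bar>dotn d w z + b\<bar>)) \<partial>lebn d) \<le> (4 * KT + 2) * a"
      if w: "normn d w \<le> 1" for w b
    proof -
      have "(\<integral>z. p1 \<tau> d z * (normn d w / (1 + \<bar>dotn d w z + b\<bar>)) \<partial>lebn d)
          \<le> 4 * ln (2 + D) * (KT * t) + 2 / (1 + D)"
        using KT by (intro p1_local TV w D) (auto simp: t_def)
      also have "\<dots> = 4 * KT * (ln (2 + D) * t) + 2 * (1 / (1 + D))" by simp
      also have "\<dots> \<le> 4 * KT * a + 2 * a"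
        using elim KT by (intro add_mono mult_left_mono) (auto simp: D_def t_def a_def)
      finally show ?thesis by (simp add: distrib_right)
    qed
    have KA: "(\<integral>z. p1 \<tau> d z * indicator {z. normn d z \<le> real d powr (1 / \<tau>) + c} z \<partial>lebn d) \<le> M c * a"
    proof -
      have "(\<integral>z. p1 \<tau> d z * indicator {z. normn d z \<le> real d powr (1 / \<tau>) + c} z \<partial>lebn d) \<le> M c * exp (- \<gamma> * real d)"
        unfolding M_def \<gamma>_def by (rule p1_ball_decay[OF \<tau> c d(2)])
      also have "\<dots> \<le> M c * a" using elim M[of c] by (intro mult_left_mono) (auto simp: a_def)
      finally show ?thesis .
    qed
    show ?case
    proof
      fix f assume f: "f \<in> local_planar_flows d c"
      have "L1_norm d (\<lambda>z. push_density d f (p d) z - p d z)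
        \<le> Cp * (1 + E) * (M c * a) + Cg * c * E * a + Cp * E * c * ((4 * KT + 2) * a)"
        unfolding E_def a_def
        by (rule L1_norm_push_density_le[OF \<tau> d(2) p[OF d(1)] Cp(1) _ Cg(1) _ f])
          (use elim KA KB in \<open>auto simp: a_def\<close>)
      also have "\<dots> = (K - 1) * a" by (simp add: K_def algebra_simps)
      also have "\<dots> \<le> K * a" by (simp add: a_def mult_right_mono)
      finally show "L1_norm d (\<lambda>z. push_density d f (p d) z - p d z) \<le> K * real d powr (1 - 1 / \<tau>)"
        by (simp add: a_def)
    qed
  qed
  with K show ?thesis by (rule that)
qed

text \<open>Turns the loss per layer into a count: the layers together must remove all of the
  distance except \<epsilon>. If no composition is accurate enough the infimum is infinite;
  otherwise it is attained, as the extended naturals are well ordered.\<close>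

lemma T_flow_lower_bound:
  assumes p: "integrable (lebn d) p" and q: "integrable (lebn d) q"
    and L: "\<And>f. f \<in> local_planar_flows d c \<Longrightarrow> L1_norm d (\<lambda>z. push_density d f p z - p z) \<le> L" "0 < L"
  shows "ereal ((L1_norm d (\<lambda>z. p z - q z) - \<epsilon>) / L) \<le> ereal_of_enat (T_flow d \<epsilon> p q (local_planar_flows d c))"
proof -
  define S where "S = {enat n | n. \<exists>fs. length fs = n \<and> set fs \<subseteq> local_planar_flows d c \<and>
            L1_norm d (\<lambda>z. push_density d (foldr (\<circ>) fs id) q z - p z) \<le> \<epsilon>}"
  have T: "T_flow d \<epsilon> p q (local_planar_flows d c) = Inf S" by (simp only: T_flow_def S_def)
  show ?thesis
  proof (cases "S = {}")
    case True
    then show ?thesis unfolding T by (simp add: top_enat_def)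
  next
    case False
    then have "Inf S \<in> S" using wellorder_InfI by blast
    then obtain fs where fs: "Inf S = enat (length fs)" "set fs \<subseteq> local_planar_flows d c"
      "L1_norm d (\<lambda>z. push_density d (foldr (\<circ>) fs id) q z - p z) \<le> \<epsilon>"
      unfolding S_def by blast
    have "L1_norm d (\<lambda>z. q z - p z) \<le> \<epsilon> + real (length fs) * L"
      using L1_norm_flow_composition[OF L(1) p q fs(2)] fs(3) by linarith
    moreover have "L1_norm d (\<lambda>z. q z - p z) = L1_norm d (\<lambda>z. p z - q z)"
      by (simp only: L1_norm_def abs_minus_commute)
    ultimately have "(L1_norm d (\<lambda>z. p z - q z) - \<epsilon>) / L \<le> real (length fs)"
      using L(2) by (simp add: divide_le_eq)
    then show ?thesis unfolding T fs(1) by simp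
  qed
qed

theorem theorem5p2:
  fixes \<tau> c\<^sub>h :: real
    and p q :: "nat \<Rightarrow> (nat \<Rightarrow> real) \<Rightarrow> real"
  assumes tau: "0 < \<tau>" "\<tau> < 1"
    and p_density: "\<And>d. d > 2 \<Longrightarrow> is_density d (p d)"
    and p_bound: "\<exists>C. \<forall>\<^sub>F d in sequentially. \<forall>z\<in>Rn d. p d z \<le> C * p1 \<tau> d z"
    and grad_bound: "\<exists>C. \<forall>\<^sub>F d in sequentially. \<forall>z\<in>Rn d. diffn d (p2 \<tau> d) z \<longrightarrow>
           diffn d (p d) z \<and>
           normn d (gradn d (p d) z) \<le> C * normn d (gradn d (p2 \<tau> d) z)"
    and q_density: "\<And>d. d > 2 \<Longrightarrow> is_density d (q d)"
    and pq: "(\<lambda>d. L1_norm d (\<lambda>z. p d z - q d z)) \<in> \<Theta>(\<lambda>_. 1)"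
  shows "\<exists>\<epsilon> :: nat \<Rightarrow> real. (\<forall>d. 0 < \<epsilon> d) \<and> \<epsilon> \<in> \<Theta>(\<lambda>_. 1) \<and>
           (\<exists>K>0. \<forall>\<^sub>F d in sequentially.
              ereal (K * min (ln (real d) powr (- 1 / \<tau>) * real d powr (1 / \<tau> - 1 / 2))
                             (real d powr (1 / \<tau> - 1)))
              \<le> ereal_of_enat (T_flow d (\<epsilon> d) (p d) (q d) (local_planar_flows d c\<^sub>h)))"
proof -
  from p_bound obtain C1 where C1: "\<forall>\<^sub>F d in sequentially. \<forall>z\<in>Rn d. p d z \<le> C1 * p1 \<tau> d z" by blast
  \<comment> \<open>The given constants may be negative; truncation at 0 keeps both bounds, since
    \<open>p1\<close> and the norms are nonnegative.\<close>
  have Cp: "\<forall>\<^sub>F d in sequentially. \<forall>z\<in>Rn d. p d z \<le> max C1 0 * p1 \<tau> d z"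
    using C1 by eventually_elim (meson max.cobounded1 mult_right_mono order_trans p1_nonneg)
  from grad_bound obtain C2 where C2: "\<forall>\<^sub>F d in sequentially. \<forall>z\<in>Rn d. diffn d (p2 \<tau> d) z \<longrightarrow>
      diffn d (p d) z \<and> normn d (gradn d (p d) z) \<le> C2 * normn d (gradn d (p2 \<tau> d) z)" by blast
  have Cg: "\<forall>\<^sub>F d in sequentially. \<forall>z\<in>Rn d. diffn d (p2 \<tau> d) z \<longrightarrow>
      diffn d (p d) z \<and> normn d (gradn d (p d) z) \<le> max C2 0 * normn d (gradn d (p2 \<tau> d) z)"
    using C2 by eventually_elim (meson max.cobounded1 mult_right_mono order_trans L2_set_nonneg)
  obtain K where K: "0 < K" "\<forall>\<^sub>F d in sequentially. \<forall>f\<in>local_planar_flows d c\<^sub>h.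
      L1_norm d (\<lambda>z. push_density d f (p d) z - p d z) \<le> K * real d powr (1 - 1 / \<tau>)"
    using eventually_flow_displacement[OF tau p_density _ Cp _ Cg] by auto
  have "(\<lambda>d. L1_norm d (\<lambda>z. p d z - q d z)) \<in> \<Omega>(\<lambda>_. 1)" using pq by blast
  then obtain c0 where c0: "0 < c0" "\<forall>\<^sub>F d in sequentially. c0 \<le> L1_norm d (\<lambda>z. p d z - q d z)"
    by (elim landau_omega.bigE) auto
  \<comment> \<open>Taking half of the eventual lower bound \<open>c0\<close> of the initial
    distance as \<epsilon> leaves at least \<open>c0 / 2\<close> to be covered in steps of length at
    most \<open>L\<close>.\<close>
  have "\<forall>\<^sub>F d in sequentially.
      ereal (c0 / (2 * K) * min (ln (real d) powr (- 1 / \<tau>) * real d powr (1 / \<tau> - 1 / 2))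
                                (real d powr (1 / \<tau> - 1)))
      \<le> ereal_of_enat (T_flow d (c0 / 2) (p d) (q d) (local_planar_flows d c\<^sub>h))"
    using K(2) c0(2) eventually_gt_at_top[of 2]
  proof eventually_elim
    case (elim d)
    define L where "L = K * real d powr (1 - 1 / \<tau>)"
    have L: "0 < L" using K elim by (simp add: L_def)
    \<comment> \<open>The reciprocal of the displacement bound is the second entry of the minimum,
      up to the constant \<open>K\<close>.\<close>
    have "c0 / (2 * K) * min (ln (real d) powr (- 1 / \<tau>) * real d powr (1 / \<tau> - 1 / 2)) (real d powr (1 / \<tau> - 1))
        \<le> c0 / (2 * K) * real d powr (1 / \<tau> - 1)"
      using c0 K by (intro mult_left_mono) auto
    also have "\<dots> = (c0 / 2) / L"
      using powr_minus_divide[of "real d" "1 - 1 / \<tau>"] by (simp add: L_def)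
    also have "\<dots> \<le> (L1_norm d (\<lambda>z. p d z - q d z) - c0 / 2) / L"
      using elim L by (intro divide_right_mono) auto
    finally have "ereal (c0 / (2 * K) * min (ln (real d) powr (- 1 / \<tau>) * real d powr (1 / \<tau> - 1 / 2)) (real d powr (1 / \<tau> - 1)))
        \<le> ereal ((L1_norm d (\<lambda>z. p d z - q d z) - c0 / 2) / L)" by simp
    also have "\<dots> \<le> ereal_of_enat (T_flow d (c0 / 2) (p d) (q d) (local_planar_flows d c\<^sub>h))"
      using p_density[of d] q_density[of d] elim L
      by (intro T_flow_lower_bound) (auto simp: is_density_def L_def)
    finally show ?case .
  qed
  moreover have "0 < c0 / (2 * K)" using c0 K by simp
  ultimately show ?thesis
    using c0(1) by (intro exI[of _ "\<lambda>_. c0 / 2"] conjI exI[of _ "c0 / (2 * K)"]) auto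
qed

end
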